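(* All Platonic solids are of Jensen-type. That is, if $X\subset\mathbb{R}^3$ is a Platonic solid, then for every convex function $f\colon X\to\mathbb{R}$, $$\frac{1}{|X|}\int_X f(x)\,dx \le \frac{1}{|\partial X|}\int_{\partial X} f(x)\,dx .$$
   Context: The Platonic solids are the regular convex polyhedra in $\mathbb{R}^3$ (tetrahedron, cube, octahedron, dodecahedron, icosahedron), regarded as solid bodies. A convex and closed shape $X$ is called of Jensen-type if the displayed inequality is satisfied for every convex function $f\colon X\to\mathbb{R}$. Here $\partial X$ is the boundary of $X$, $|X|$ is the volume of $X$, $|\partial X|$ is the surface area of $\partial X$, and the integrals are taken with respect to these measures. *)

theory Defs
  imports "HOL-Analysis.Analysis"
begin

text \<open>Regular convex polyhedra: a flag is an incident triple (vertex, edge, two-dimensional face),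
  and a convex polyhedron is regular if its symmetry group acts transitively on its flags. In
  dimension 3 these are, up to similarity, exactly the tetrahedron, cube, octahedron, dodecahedron
  and icosahedron.\<close>

definition is_flag :: "(real^3) set \<Rightarrow> (real^3) set \<Rightarrow> (real^3) set \<Rightarrow> (real^3) set \<Rightarrow> bool" where
  "is_flag X V E F \<longleftrightarrow>
     V face_of X \<and> aff_dim V = 0 \<and>
     E face_of X \<and> aff_dim E = 1 \<and>
     F face_of X \<and> aff_dim F = 2 \<and>
     V \<subseteq> E \<and> E \<subseteq> F"

definition is_symmetry :: "(real^3) set \<Rightarrow> (real^3 \<Rightarrow> real^3) \<Rightarrow> bool" where
  "is_symmetry X g \<longleftrightarrow> (\<forall>x y. dist (g x) (g y) = dist x y) \<and> g ` X = X"

definition platonic_solid :: "(real^3) set \<Rightarrow> bool" where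
  "platonic_solid X \<longleftrightarrow>
     polytope X \<and> interior X \<noteq> {} \<and>
     (\<forall>V E F V' E' F'. is_flag X V E F \<longrightarrow> is_flag X V' E' F' \<longrightarrow>
        (\<exists>g. is_symmetry X g \<and> g ` V = V' \<and> g ` E = E' \<and> g ` F = F'))"

text \<open>Surface area is the two-dimensional Hausdorff measure, restricted to Borel sets. A covering
  set \<open>C\<close> contributes the area of a disc of diameter \<open>diameter C\<close>; with this normalisation the
  measure agrees with Lebesgue measure on planes and with surface area on smooth and polyhedral
  surfaces. Boundedness is required because \<^const>\<open>diameter\<close> is unspecified on unbounded sets.\<close>

definition area_premeasure :: "real \<Rightarrow> ('a::metric_space) set \<Rightarrow> ennreal" where
  "area_premeasure \<delta> A =
     (INF C \<in> {C :: nat \<Rightarrow> 'a set. A \<subseteq> (\<Union>i. C i) \<and> (\<forall>i. bounded (C i) \<and> diameter (C i) \<le> \<delta>)}.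
        (\<Sum>i. ennreal (pi * (diameter (C i) / 2)\<^sup>2)))"

definition area_outer :: "('a::metric_space) set \<Rightarrow> ennreal" where
  "area_outer A = (SUP \<delta> \<in> {0<..}. area_premeasure \<delta> A)"

definition area_measure :: "('a::metric_space) measure" where
  "area_measure = measure_of UNIV (sets borel) area_outer"

text \<open>The convex functions are real-valued on \<open>X\<close> itself, boundary included, and need not be
  continuous at the boundary. Both integrals are required to exist, so that the inequality is never
  a statement about the default value of an undefined integral. For a convex polytope with nonempty
  interior they always do: convex functions are bounded on it and continuous on the relative
  interior of each of its finitely many faces.\<close>

definition jensen_type :: "(real^3) set \<Rightarrow> bool" where
  "jensen_type X \<longleftrightarrow>
     convex X \<and> closed X \<and>
     (\<forall>f. convex_on X f \<longrightarrow>
        set_integrable lebesgue X f \<and>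
        set_integrable area_measure (frontier X) f \<and>
        1 / measure lebesgue X * (LINT x:X|lebesgue. f x)
          \<le> 1 / measure area_measure (frontier X) * (LINT x:frontier X|area_measure. f x))"

end

theory Submission
  imports Defs
begin

text \<open>Let \<open>s\<close> be the centroid of the surface. It is fixed by every symmetry of \<open>X\<close>, and the symmetries
  permute the facets transitively, so \<open>s\<close> is interior and the cones from \<open>s\<close> over the facets have equal
  volume. In polar coordinates around \<open>s\<close>, Lebesgue measure on each cone is therefore
  \<open>C t\<^sup>2 dt dA(y)\<close> with one constant \<open>C\<close> for all facets. Integrating
  \<open>f (s + t (y - s)) \<le> (1 - t) f s + t f y\<close> bounds the mean of \<open>f\<close> over \<open>X\<close> by
  \<open>(f s + 3 m) / 4\<close>, where \<open>m\<close> is the mean over the surface, and \<open>f s \<le> m\<close> by Jensen's inequality.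

  Only ratios enter, so it suffices to know that Hausdorff measure on a plane is some positive finite
  multiple of Lebesgue measure, which follows from translation invariance.\<close>

section \<open>Two-dimensional Hausdorff measure\<close>

text \<open>The constant \<open>C\<close> of a cone is, up to the normalisation of area, the height
  of the apex above the plane of the facet. For a general polytope it varies with the facet: the
  mean over the body then weights facets by height while the mean over the surface does not, and
  symmetry is what reconciles the two weightings. The surface centroid is the right apex because
  Jensen's inequality for the surface measure is a statement about the value of \<open>f\<close>
  there. The weights 1/4 and 3/4 are three times the integrals of \<open>t^2 (1 - t)\<close> and of
  \<open>t^3\<close> over the unit interval. Two obstacles shape the preparations.
  \<open>measure_of\<close> yields the zero measure unless \<open>area_outer\<close> is shown to be
  a measure on the Borel sets, so Caratheodory's construction has to be carried out. And
  \<open>f\<close> may jump at the boundary, so measurability comes from continuity on the relative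
  interior of each face, and integrability from explicit bounds.\<close>

abbreviation disc_area :: "('a::metric_space) set \<Rightarrow> ennreal" where
  "disc_area C \<equiv> ennreal (pi * (diameter C / 2)\<^sup>2)"

abbreviation fine_cover :: "real \<Rightarrow> ('a::metric_space) set \<Rightarrow> (nat \<Rightarrow> 'a set) \<Rightarrow> bool" where
  "fine_cover \<delta> A C \<equiv> A \<subseteq> (\<Union>i. C i) \<and> (\<forall>i. bounded (C i) \<and> diameter (C i) \<le> \<delta>)"

lemma area_premeasure_le:
  assumes "fine_cover \<delta> A C"
  shows "area_premeasure \<delta> A \<le> (\<Sum>i. disc_area (C i))"
  unfolding area_premeasure_def by (rule INF_lower) (use assms in auto)

lemma area_premeasure_greatest:
  assumes "\<And>C. fine_cover \<delta> A C \<Longrightarrow> z \<le> (\<Sum>i. disc_area (C i))"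
  shows "z \<le> area_premeasure \<delta> A"
  unfolding area_premeasure_def by (rule INF_greatest) (use assms in auto)

lemma area_premeasure_mono: "A \<subseteq> B \<Longrightarrow> area_premeasure \<delta> A \<le> area_premeasure \<delta> B"
  by (rule area_premeasure_greatest, rule area_premeasure_le) auto

lemma area_premeasure_antimono: "\<epsilon> \<le> \<delta> \<Longrightarrow> area_premeasure \<delta> A \<le> area_premeasure \<epsilon> A"
  by (rule area_premeasure_greatest, rule area_premeasure_le) (auto intro: order_trans)

lemma area_premeasure_empty: "0 < \<delta> \<Longrightarrow> area_premeasure \<delta> {} = 0"
  using area_premeasure_le[of "{}" "\<lambda>_. {}" \<delta>] by simp

text \<open>Only a finite right-hand side needs an argument. Then each \<open>A n\<close> has a
  cover within \<open>e / 2^(n+1)\<close> of the infimum; these covers are merged along the pairing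
  bijection, and the errors sum to \<open>e\<close>.\<close>

lemma area_premeasure_UN_le:
  "area_premeasure \<delta> (\<Union>n. A n) \<le> (\<Sum>n. area_premeasure \<delta> (A n :: 'a::metric_space set))"
proof (rule ennreal_le_epsilon)
  fix e :: real assume e: "0 < e" and fin: "(\<Sum>n. area_premeasure \<delta> (A n)) < top"
  have lt: "area_premeasure \<delta> (A n) < area_premeasure \<delta> (A n) + e * (1/2)^Suc n" for n
    using e fin by (auto simp add: less_top dest!: ennreal_suminf_lessD)
  have "\<exists>C. fine_cover \<delta> (A n) C \<and> (\<Sum>i. disc_area (C i)) \<le> area_premeasure \<delta> (A n) + e * (1/2)^Suc n" for n
  proof (rule ccontr)
    assume "\<nexists>C. fine_cover \<delta> (A n) C \<and> (\<Sum>i. disc_area (C i)) \<le> area_premeasure \<delta> (A n) + e * (1/2)^Suc n"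
    then have "area_premeasure \<delta> (A n) + e * (1/2)^Suc n \<le> area_premeasure \<delta> (A n)"
      by (intro area_premeasure_greatest) (meson linear)
    with lt[of n] show False by simp
  qed
  then obtain B where B: "\<And>n. fine_cover \<delta> (A n) (B n)"
    and Ble: "\<And>n. (\<Sum>i. disc_area (B n i)) \<le> area_premeasure \<delta> (A n) + e * (1/2)^Suc n"
    by metis
  define C where "C = case_prod B \<circ> prod_decode"
  have "(\<Union>n. A n) \<subseteq> (\<Union>i. C i)"
  proof
    fix x assume "x \<in> (\<Union>n. A n)"
    then obtain n i where "x \<in> B n i" using B by blast
    then have "x \<in> C (prod_encode (n, i))" by (simp add: C_def)
    then show "x \<in> (\<Union>i. C i)" by blast
  qed
  then have "fine_cover \<delta> (\<Union>n. A n) C"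
    using B by (auto simp: C_def split_def)
  then have "area_premeasure \<delta> (\<Union>n. A n) \<le> (\<Sum>i. disc_area (C i))"
    by (rule area_premeasure_le)
  also have "\<dots> = (\<Sum>i. (case prod_decode i of (n, i) \<Rightarrow> disc_area (B n i)))"
    by (simp only: C_def comp_def split_def)
  also have "\<dots> = (\<Sum>n. \<Sum>i. disc_area (B n i))"
    by (rule suminf_ennreal_2dimen) (simp only: prod.case)
  also have "\<dots> \<le> (\<Sum>n. area_premeasure \<delta> (A n) + e * (1/2) ^ Suc n)"
    by (intro suminf_le Ble) auto
  also have "\<dots> = (\<Sum>n. area_premeasure \<delta> (A n)) + (\<Sum>n. ennreal e * ennreal ((1/2) ^ Suc n))"
    using e by (subst suminf_add[symmetric])
      (auto simp del: ennreal_suminf_cmult simp add: ennreal_mult[symmetric])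
  also have "\<dots> = (\<Sum>n. area_premeasure \<delta> (A n)) + e"
    unfolding ennreal_suminf_cmult
    by (subst suminf_ennreal_eq[OF zero_le_power power_half_series]) auto
  finally show "area_premeasure \<delta> (\<Union>n. A n) \<le> (\<Sum>n. area_premeasure \<delta> (A n)) + e" .
qed

lemma area_premeasure_le_outer: "0 < \<delta> \<Longrightarrow> area_premeasure \<delta> A \<le> area_outer A"
  unfolding area_outer_def by (rule SUP_upper) auto

lemma area_outer_least: "(\<And>\<delta>. 0 < \<delta> \<Longrightarrow> area_premeasure \<delta> A \<le> z) \<Longrightarrow> area_outer A \<le> z"
  unfolding area_outer_def by (rule SUP_least) auto

lemma area_outer_mono: "A \<subseteq> B \<Longrightarrow> area_outer A \<le> area_outer B"
  by (intro area_outer_least)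
    (meson area_premeasure_le_outer area_premeasure_mono order_trans)

lemma area_outer_empty: "area_outer {} = 0"
  by (metis area_outer_least area_premeasure_empty le_zero_eq order_refl)

lemma area_outer_UN_le: "area_outer (\<Union>n. A n) \<le> (\<Sum>n. area_outer (A n))"
proof (rule area_outer_least)
  fix \<delta> :: real assume "0 < \<delta>"
  have "area_premeasure \<delta> (\<Union>n. A n) \<le> (\<Sum>n. area_premeasure \<delta> (A n))"
    by (rule area_premeasure_UN_le)
  also have "\<dots> \<le> (\<Sum>n. area_outer (A n))"
    by (intro suminf_le area_premeasure_le_outer \<open>0 < \<delta>\<close>) auto
  finally show "area_premeasure \<delta> (\<Union>n. A n) \<le> (\<Sum>n. area_outer (A n))" .
qed

lemma area_outer_Un_le: "area_outer (A \<union> B) \<le> area_outer A + area_outer B"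
proof -
  have "area_outer (A \<union> B) = area_outer (\<Union>n. binaryset A B n)"
    by (simp add: UN_binaryset_eq)
  also have "\<dots> \<le> (\<Sum>n. area_outer (binaryset A B n))"
    by (rule area_outer_UN_le)
  also have "\<dots> = area_outer A + area_outer B"
    by (rule suminf_binaryset_eq) (rule area_outer_empty)
  finally show ?thesis .
qed

text \<open>A set of diameter at most \<open>\<delta>\<close> cannot meet both \<open>A\<close> and
  \<open>B\<close>, so every cover of the union splits into a cover of \<open>A\<close> and a cover
  of \<open>B\<close>.\<close>

lemma area_premeasure_separated:
  assumes sep: "\<And>x y. x \<in> A \<Longrightarrow> y \<in> B \<Longrightarrow> \<delta> < dist x y" and "0 < \<delta>"
  shows "area_premeasure \<delta> A + area_premeasure \<delta> B \<le> area_premeasure \<delta> (A \<union> B)"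
proof (rule area_premeasure_greatest)
  fix C assume C: "fine_cover \<delta> (A \<union> B) C"
  \<comment> \<open>Discarded members become \<open>{}\<close>, of diameter 0, so the two sums add
    up term by term to the original one. Members meeting neither set end up in
    \<open>CB\<close>.\<close>
  define CA CB where "CA i = (if C i \<inter> A = {} then {} else C i)"
    and "CB i = (if C i \<inter> A = {} then C i else {})" for i
  have "B \<subseteq> (\<Union>i. CB i)"
  proof
    fix y assume y: "y \<in> B"
    then obtain i where i: "y \<in> C i" using C by blast
    have "C i \<inter> A = {}"
    proof (rule ccontr)
      assume "C i \<inter> A \<noteq> {}"
      then obtain x where x: "x \<in> C i" "x \<in> A" by blast
      have "dist x y \<le> diameter (C i)" using C i x by (intro diameter_bounded_bound) auto
      with sep[OF x(2) y] C show False by (meson leD order_trans)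
    qed
    with i show "y \<in> (\<Union>i. CB i)" by (auto simp: CB_def)
  qed
  then have B: "fine_cover \<delta> B CB" using C \<open>0 < \<delta>\<close> by (auto simp: CB_def)
  have A: "fine_cover \<delta> A CA" using C \<open>0 < \<delta>\<close> by (fastforce simp: CA_def)
  have "area_premeasure \<delta> A + area_premeasure \<delta> B
      \<le> (\<Sum>i. disc_area (CA i)) + (\<Sum>i. disc_area (CB i))"
    by (intro add_mono area_premeasure_le A B)
  also have "\<dots> = (\<Sum>i. disc_area (CA i) + disc_area (CB i))"
    by (rule suminf_add) auto
  also have "\<dots> = (\<Sum>i. disc_area (C i))"
    by (intro suminf_cong) (auto simp: CA_def CB_def)
  finally show "area_premeasure \<delta> A + area_premeasure \<delta> B \<le> (\<Sum>i. disc_area (C i))" .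
qed

text \<open>Premeasures grow as the scale shrinks, so the two suprema can be taken along a common
  scale, and only scales below \<open>d\<close> matter.\<close>

lemma area_outer_separated:
  assumes sep: "\<And>x y. x \<in> A \<Longrightarrow> y \<in> B \<Longrightarrow> d \<le> dist x y" and "0 < d"
  shows "area_outer A + area_outer B \<le> area_outer (A \<union> B)"
proof -
  have "area_outer A + area_outer B = (SUP \<delta>\<in>{0<..}. area_premeasure \<delta> A + area_premeasure \<delta> B)"
    unfolding area_outer_def
  proof (rule SUP_add_directed_ennreal[symmetric])
    fix i j :: real assume "i \<in> {0<..}" "j \<in> {0<..}"
    then show "\<exists>k\<in>{0<..}. area_premeasure i A + area_premeasure j B
        \<le> area_premeasure k A + area_premeasure k B"
      by (intro bexI[of _ "min i j"] add_mono area_premeasure_antimono) auto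
  qed
  also have "\<dots> \<le> area_outer (A \<union> B)"
  proof (rule SUP_least)
    fix \<delta> :: real assume "\<delta> \<in> {0<..}"
    \<comment> \<open>Half of \<open>d\<close>, because additivity at scale
      \<open>\<epsilon>\<close> requires distances strictly larger than
      \<open>\<epsilon>\<close>.\<close>
    define \<epsilon> where "\<epsilon> = min \<delta> (d/2)"
    have \<epsilon>: "0 < \<epsilon>" "\<epsilon> \<le> \<delta>" "\<epsilon> < d" using \<open>\<delta> \<in> _\<close> \<open>0 < d\<close> by (auto simp: \<epsilon>_def)
    have "area_premeasure \<delta> A + area_premeasure \<delta> B \<le> area_premeasure \<epsilon> A + area_premeasure \<epsilon> B"
      using \<epsilon> by (intro add_mono area_premeasure_antimono)
    also have "\<dots> \<le> area_premeasure \<epsilon> (A \<union> B)"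
      using \<epsilon> sep by (intro area_premeasure_separated) (auto intro: less_le_trans)
    also have "\<dots> \<le> area_outer (A \<union> B)"
      by (rule area_premeasure_le_outer) (rule \<epsilon>)
    finally show "area_premeasure \<delta> A + area_premeasure \<delta> B \<le> area_outer (A \<union> B)" .
  qed
  finally show ?thesis .
qed

lemma sum_lessThan_double: "sum g {..<2 * N} = (\<Sum>j<N. g (2 * j) + g (Suc (2 * j)))"
  for g :: "nat \<Rightarrow> 'b::comm_monoid_add"
  by (induction N) (auto simp: add_ac)

text \<open>Caratheodory's criterion for metric outer measures: the shells \<open>R k\<close> around a closed set
  \<open>A\<close> are pairwise separated when their indices differ by at least two, so the sum of their
  measures converges and its tails bound what \<open>T n\<close> misses of \<open>S - A\<close>.\<close>

lemma area_outer_closed_split: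
  fixes A :: "'a::metric_space set"
  assumes "closed A"
  shows "area_outer (S \<inter> A) + area_outer (S - A) \<le> area_outer S"
proof (cases "A = {} \<or> area_outer S = \<infinity>")
  case True
  then show ?thesis by (auto simp: area_outer_empty)
next
  case False
  then have ne: "A \<noteq> {}" and fin: "area_outer S < \<infinity>" by (auto simp: less_top)
  define T where "T n = {x \<in> S. 1 / real (Suc n) \<le> infdist x A}" for n
  define R where "R k = {x \<in> S. 1 / real (Suc (Suc k)) \<le> infdist x A \<and> infdist x A < 1 / real (Suc k)}" for k
  have T: "area_outer (S \<inter> A) + area_outer (T n) \<le> area_outer S" for n
  proof -
    have "area_outer (S \<inter> A) + area_outer (T n) \<le> area_outer ((S \<inter> A) \<union> T n)"
    proof (rule area_outer_separated)
      fix x y assume "x \<in> S \<inter> A" "y \<in> T n"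
      then show "1 / real (Suc n) \<le> dist x y"
        using infdist_le[of x A y] by (auto simp: T_def dist_commute)
    qed auto
    also have "\<dots> \<le> area_outer S" by (rule area_outer_mono) (auto simp: T_def)
    finally show ?thesis .
  qed
  have every_other: "(\<Sum>j<N. area_outer (R (2 * j + p))) \<le> area_outer (\<Union>j<N. R (2 * j + p))" for N p
  proof (induction N)
    case (Suc N)
    have "(\<Sum>j<Suc N. area_outer (R (2 * j + p)))
        \<le> area_outer (\<Union>j<N. R (2 * j + p)) + area_outer (R (2 * N + p))"
      using Suc by (simp add: add_right_mono)
    also have "\<dots> \<le> area_outer ((\<Union>j<N. R (2 * j + p)) \<union> R (2 * N + p))"
    proof (cases N)
      case 0
      then show ?thesis by (simp add: area_outer_empty)
    next
      case (Suc M)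
      \<comment> \<open>Earlier shells of the same parity keep distance at least
        \<open>1 / ?m\<close> from \<open>A\<close>, while the points of shell \<open>?m\<close> are
        closer than \<open>1 / (?m + 1)\<close>. As \<open>infdist\<close> is 1-Lipschitz, the
        difference separates them. The case \<open>N = 0\<close> is treated apart because
        \<open>?m\<close> could then be 0.\<close>
      let ?m = "real (2 * N + p)"
      have m: "0 < ?m" using Suc by simp
      show ?thesis
      proof (rule area_outer_separated)
        have "1 / (t + 1) < 1 / t" if "0 < t" for t :: real
          using that by (simp add: field_simps)
        from this[OF m] show "0 < 1 / ?m - 1 / (?m + 1)" by linarith
        fix x y assume x: "x \<in> (\<Union>j<N. R (2 * j + p))" and y: "y \<in> R (2 * N + p)"
        from x obtain j where j: "j < N" "x \<in> R (2 * j + p)" by auto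
        have "1 / ?m \<le> 1 / real (Suc (Suc (2 * j + p)))"
          using j m by (intro divide_left_mono) (auto simp: mult_pos_pos)
        also have "\<dots> \<le> infdist x A" using j by (simp add: R_def)
        finally have "1 / ?m \<le> infdist x A" .
        moreover have "infdist y A < 1 / (?m + 1)" using y by (simp add: R_def add_ac)
        ultimately show "1 / ?m - 1 / (?m + 1) \<le> dist x y"
          using infdist_triangle[of x A y] by linarith
      qed
    qed
    also have "(\<Union>j<N. R (2 * j + p)) \<union> R (2 * N + p) = (\<Union>j<Suc N. R (2 * j + p))"
      by (auto simp: less_Suc_eq)
    finally show ?case .
  qed (simp add: area_outer_empty)
  have bound: "(\<Sum>j<N. area_outer (R (2 * j + p))) \<le> area_outer S" for N p
    by (rule order_trans[OF every_other area_outer_mono]) (auto simp: R_def)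
  \<comment> \<open>The even and the odd shells are bounded by \<open>area_outer S\<close>
    separately, whence two summands.\<close>
  have "(\<Sum>k. area_outer (R k)) \<le> area_outer S + area_outer S"
  proof (rule suminf_le_const)
    fix n
    have "(\<Sum>k<n. area_outer (R k)) \<le> (\<Sum>k<2 * n. area_outer (R k))"
      by (rule sum_mono2) auto
    also have "\<dots> = (\<Sum>j<n. area_outer (R (2 * j + 0))) + (\<Sum>j<n. area_outer (R (2 * j + 1)))"
      by (simp add: sum_lessThan_double sum.distrib)
    also have "\<dots> \<le> area_outer S + area_outer S"
      by (intro add_mono bound)
    finally show "(\<Sum>k<n. area_outer (R k)) \<le> area_outer S + area_outer S" .
  qed auto
  then have finR: "(\<Sum>k. area_outer (R k)) < \<infinity>"
    by (rule le_less_trans) (use fin in simp)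
  have cover: "S - A \<subseteq> T n \<union> (\<Union>k. R (k + n))" for n
  proof
    fix x assume x: "x \<in> S - A"
    then have "0 < infdist x A"
      using in_closed_iff_infdist_zero[OF \<open>closed A\<close> ne] infdist_nonneg[of x A] by force
    then have ex: "\<exists>m. 1 / real (Suc m) \<le> infdist x A"
      using reals_Archimedean[of "infdist x A"] by (auto simp: inverse_eq_divide intro: less_imp_le)
    \<comment> \<open>The least index whose threshold is reached by \<open>x\<close>: if it is at
      most \<open>n\<close>, then \<open>x\<close> lies in \<open>T n\<close>; beyond
      \<open>n\<close>, minimality puts \<open>x\<close> into the shell of index
      \<open>m - 1\<close>.\<close>
    define m where "m = (LEAST m. 1 / real (Suc m) \<le> infdist x A)"
    have m: "1 / real (Suc m) \<le> infdist x A" unfolding m_def by (rule LeastI_ex) (rule ex)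
    show "x \<in> T n \<union> (\<Union>k. R (k + n))"
    proof (cases "m \<le> n")
      case True
      then have "1 / real (Suc n) \<le> 1 / real (Suc m)" by (simp add: frac_le)
      with m x show ?thesis by (auto simp: T_def)
    next
      case False
      then obtain k where k: "m = Suc (k + n)" by (metis add.commute less_natE not_le)
      have "\<not> 1 / real (Suc (k + n)) \<le> infdist x A"
        unfolding m_def[symmetric] using not_less_Least[of "k + n" "\<lambda>m. 1 / real (Suc m) \<le> infdist x A"]
        using k m_def by simp
      with m k x have "x \<in> R (k + n)" by (auto simp: R_def)
      then show ?thesis by blast
    qed
  qed
  show ?thesis
  proof (rule ennreal_le_epsilon)
    fix e :: real assume "0 < e"
    have "(\<Sum>k<n. area_outer (R k)) < \<infinity>" for n
      using finR by (rule le_less_trans[rotated]) (auto intro: sum_le_suminf)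
    have "(\<lambda>n. (\<Sum>k<n. area_outer (R k)) + e) \<longlonglongrightarrow> (\<Sum>k. area_outer (R k)) + e"
      by (intro tendsto_intros summable_LIMSEQ) auto
    moreover have "(\<Sum>k. area_outer (R k)) < (\<Sum>k. area_outer (R k)) + e"
      using finR \<open>0 < e\<close> by (auto simp: less_top)
    ultimately have "\<forall>\<^sub>F n in sequentially. (\<Sum>k. area_outer (R k)) < (\<Sum>k<n. area_outer (R k)) + e"
      by (rule order_tendstoD)
    then obtain n where "(\<Sum>k. area_outer (R k)) < (\<Sum>k<n. area_outer (R k)) + e"
      by (auto simp: eventually_sequentially)
    then have "(\<Sum>k. area_outer (R (k + n))) + (\<Sum>k<n. area_outer (R k)) \<le> e + (\<Sum>k<n. area_outer (R k))"
      using suminf_offset[of "\<lambda>k. area_outer (R k)" n]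
      by (metis add.commute less_imp_le summableI)
    then have tail: "(\<Sum>k. area_outer (R (k + n))) \<le> e"
      using \<open>(\<Sum>k<n. area_outer (R k)) < \<infinity>\<close>
      by (metis add.commute ennreal_add_left_cancel_le infinity_ennreal_def less_irrefl)
    have "area_outer (S \<inter> A) + area_outer (S - A)
        \<le> area_outer (S \<inter> A) + (area_outer (T n) + area_outer (\<Union>k. R (k + n)))"
      by (intro add_left_mono order_trans[OF area_outer_mono[OF cover] area_outer_Un_le])
    also have "\<dots> \<le> area_outer (S \<inter> A) + (area_outer (T n) + e)"
      by (intro add_left_mono order_trans[OF area_outer_UN_le tail])
    also have "\<dots> \<le> area_outer S + e"
      using T[of n] by (simp add: add.assoc[symmetric] add_right_mono)
    finally show "area_outer (S \<inter> A) + area_outer (S - A) \<le> area_outer S + e" .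
  qed
qed

text \<open>By Caratheodory, an outer measure is a measure on the sigma algebra of the sets that
  split every set additively. The criterion for closed sets places all Borel sets in it.\<close>

lemma measure_space_area_outer:
  "measure_space UNIV (sets (borel :: 'a::metric_space measure)) area_outer"
proof -
  have oms: "outer_measure_space (Pow UNIV) (area_outer :: 'a set \<Rightarrow> ennreal)"
    by (auto simp: outer_measure_space_def positive_def increasing_def countably_subadditive_def
        area_outer_empty area_outer_mono area_outer_UN_le)
  let ?L = "lambda_system UNIV (Pow UNIV) (area_outer :: 'a set \<Rightarrow> ennreal)"
  have L: "measure_space UNIV ?L area_outer"
    by (rule sigma_algebra.caratheodory_lemma[OF sigma_algebra_Pow oms])
  then interpret L: sigma_algebra UNIV ?L by (simp add: measure_space_def)
  have "A \<in> ?L" if "closed A" for A :: "'a set"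
  proof -
    have "area_outer (S \<inter> A) + area_outer (S - A) = area_outer S" for S
      using area_outer_closed_split[OF that, of S] area_outer_Un_le[of "S \<inter> A" "S - A"]
      by (simp add: Un_Diff_Int antisym Un_commute)
    then show ?thesis unfolding algebra.lambda_system_eq[OF algebra_Pow] by blast
  qed
  then have "sets (borel :: 'a measure) \<subseteq> ?L"
    unfolding borel_eq_closed sets_measure_of[OF order.trans[OF subset_UNIV Pow_UNIV[THEN equalityD2]]]
    by (intro L.sigma_sets_subset) blast
  then show ?thesis
    by (intro measure_down[OF L]) (metis sets.sigma_algebra_axioms space_borel)
qed

lemma sets_area_measure [simp, measurable_cong]: "sets area_measure = sets borel"
  unfolding area_measure_def
  by (metis sets.sigma_sets_eq sets.space_closed sets_measure_of space_borel)

lemma space_area_measure [simp]: "space area_measure = UNIV"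
  unfolding area_measure_def by (simp add: space_measure_of_conv)

text \<open>\<open>measure_of\<close> hands back the given set function only when that function is a
  measure on the generated sigma algebra, and 0 otherwise; this is where Caratheodory's construction
  pays off.\<close>

lemma emeasure_area_measure:
  fixes A :: "'a::metric_space set"
  assumes "A \<in> sets borel"
  shows "emeasure area_measure A = area_outer A"
proof -
  note ms = measure_space_area_outer[where 'a = 'a, unfolded measure_space_def]
  show ?thesis
    unfolding area_measure_def
    by (rule emeasure_measure_of_sigma[OF ms[THEN conjunct1] ms[THEN conjunct2, THEN conjunct1]
        ms[THEN conjunct2, THEN conjunct2] assms])
qed

section \<open>Invariance of Hausdorff measure under isometries\<close>

lemma diameter_isometry_image:
  assumes "\<And>x y. dist (g x) (g y) = dist x y"
  shows "diameter (g ` S) = diameter S"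
proof -
  have "(\<lambda>(x,y). dist x y) ` (g ` S \<times> g ` S) = (\<lambda>(x,y). dist x y) ` (S \<times> S)"
    by (simp add: map_prod_surj_on[OF refl refl, symmetric] image_image assms split_def)
  then show ?thesis by (simp add: diameter_def)
qed

lemma bounded_isometry_image_iff:
  assumes "\<And>x y. dist (g x) (g y) = dist x y"
  shows "bounded (g ` S) \<longleftrightarrow> bounded S"
  by (simp add: bounded_two_points assms)

text \<open>Covers are transported in both directions. Images keep their diameter, and the preimage
  of a covering set has no larger diameter than that set, since \<open>g\<close> maps it
  isometrically into it. Source and target may be different spaces, as for the chart of a
  plane.\<close>

lemma area_outer_isometry_image:
  fixes g :: "'a::metric_space \<Rightarrow> 'b::metric_space"
  assumes g: "\<And>x y. dist (g x) (g y) = dist x y"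
  shows "area_outer (g ` A) = area_outer A"
proof -
  have "area_premeasure \<delta> (g ` A) = area_premeasure \<delta> A" for \<delta>
  proof (rule antisym; rule area_premeasure_greatest)
    fix C assume C: "fine_cover \<delta> A C"
    then have "g ` A \<subseteq> (\<Union>i. g ` C i)" by blast
    with C have "fine_cover \<delta> (g ` A) (\<lambda>i. g ` C i)"
      by (simp add: diameter_isometry_image[OF g] bounded_isometry_image_iff[OF g])
    from area_premeasure_le[OF this] show "area_premeasure \<delta> (g ` A) \<le> (\<Sum>i. disc_area (C i))"
      by (simp only: diameter_isometry_image[OF g])
  next
    fix C assume C: "fine_cover \<delta> (g ` A) C"
    have sub: "g ` (g -` C i) \<subseteq> C i" for i by blast
    have bdd: "bounded (g -` C i)" for i
      using bounded_subset[OF _ sub, of i] C by (simp only: bounded_isometry_image_iff[OF g])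
    have diam: "diameter (g -` C i) \<le> diameter (C i)" for i
      using diameter_subset[OF sub, of i] C by (simp only: diameter_isometry_image[OF g])
    have "fine_cover \<delta> A (\<lambda>i. g -` C i)"
    proof (intro conjI allI)
      show "A \<subseteq> (\<Union>i. g -` C i)" using C by blast
    qed (use C bdd order_trans[OF diam] in blast)+
    then have "area_premeasure \<delta> A \<le> (\<Sum>i. disc_area (g -` C i))"
      by (rule area_premeasure_le)
    also have "\<dots> \<le> (\<Sum>i. disc_area (C i))"
      using diam bdd by (intro suminf_le ennreal_leI mult_left_mono power_mono divide_right_mono)
        (auto simp: diameter_ge_0)
    finally show "area_premeasure \<delta> A \<le> (\<Sum>i. disc_area (C i))" .
  qed
  then show ?thesis by (simp add: area_outer_def)
qed

lemma continuous_on_isometry: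
  assumes "\<And>x y. dist (g x) (g y) = dist x y"
  shows "continuous_on S g"
  by (auto simp: continuous_on_iff assms)

text \<open>The change of variables for area. For the chart of a plane, the indicator restricts area
  to that plane; for a translation or a symmetry of the whole space the range is everything and area
  is invariant.\<close>

lemma distr_area_measure_isometry:
  fixes g :: "'a::metric_space \<Rightarrow> 'b::metric_space"
  assumes g: "\<And>x y. dist (g x) (g y) = dist x y" and rng: "range g \<in> sets borel"
  shows "distr area_measure borel g = density area_measure (indicator (range g))"
proof (rule measure_eqI)
  have [measurable]: "g \<in> borel_measurable borel"
    by (rule borel_measurable_continuous_onI) (rule continuous_on_isometry[OF g])
  fix B assume "B \<in> sets (distr area_measure borel g)"
  then have [measurable]: "B \<in> sets borel" by simp
  note rng[measurable]
  have "emeasure (distr area_measure borel g) B = area_outer (g -` B)"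
    using measurable_sets[of g borel borel B] by (simp add: emeasure_distr emeasure_area_measure)
  also have "\<dots> = area_outer (g ` (g -` B))"
    by (rule area_outer_isometry_image[OF g, symmetric])
  also have "g ` (g -` B) = range g \<inter> B" by auto
  also have "area_outer (range g \<inter> B) = emeasure (density area_measure (indicator (range g))) B"
    by (subst emeasure_density) (auto simp: emeasure_area_measure indicator_inter_arith[symmetric])
  finally show "emeasure (distr area_measure borel g) B
      = emeasure (density area_measure (indicator (range g))) B" .
qed simp

section \<open>Translation invariant measures\<close>

lemma density_one: "density M (\<lambda>_. 1) = M"
  by (rule measure_eqI) (simp_all add: emeasure_density)

text \<open>Evaluating \<open>\<integral>\<integral> 1\<^sub>A(x) 1\<^sub>B(y - x)\<close> in both orders, with \<open>B\<close> the unit cube, expresses \<open>M\<close> by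
  Lebesgue measure.\<close>

lemma translation_invariant_eq_lborel:
  fixes M :: "'a::euclidean_space measure"
  assumes sets_M [measurable_cong]: "sets M = sets borel"
    and inv: "\<And>a. distr M borel ((+) a) = M"
    and fin: "\<And>A. A \<in> sets borel \<Longrightarrow> bounded A \<Longrightarrow> emeasure M A < \<infinity>"
  obtains k where "k < \<infinity>" "M = density lborel (\<lambda>_. k)"
proof -
  have space_M [simp]: "space M = UNIV" using sets_eq_imp_space_eq[OF sets_M] by simp
  interpret M: sigma_finite_measure M
  proof
    show "\<exists>A. countable A \<and> A \<subseteq> sets M \<and> \<Union> A = space M \<and> (\<forall>a\<in>A. emeasure M a \<noteq> \<infinity>)"
    proof (intro exI[of _ "range (\<lambda>n. cball 0 (real n))"] conjI ballI)
      show "\<Union> (range (\<lambda>n. cball (0::'a) (real n))) = space M"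
        using real_arch_simple by fastforce
      fix a assume "a \<in> range (\<lambda>n. cball (0::'a) (real n))"
      then show "emeasure M a \<noteq> \<infinity>" using fin[of a] by auto
    qed (auto simp: sets_M)
  qed
  interpret P: pair_sigma_finite M "lborel :: 'a measure" ..
  define B where "B = cbox (0::'a) One"
  have [measurable]: "B \<in> sets borel" by (simp add: B_def)
  have B1: "emeasure lborel B = 1"
    by (simp add: B_def emeasure_lborel_cbox_eq)
  define k where "k = emeasure M (uminus -` B)"
  have [measurable]: "uminus -` B \<in> sets borel"
    using measurable_sets[of uminus borel borel B] by simp
  have shift: "(\<integral>\<^sup>+x. h (a + x) \<partial>N) = (\<integral>\<^sup>+x. h x \<partial>N)"
    if "distr N borel ((+) a) = N" "h \<in> borel_measurable borel" "sets N = sets borel"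
    for N a and h :: "'a \<Rightarrow> ennreal"
  proof -
    have "(\<integral>\<^sup>+x. h x \<partial>N) = (\<integral>\<^sup>+x. h x \<partial>distr N borel ((+) a))" by (simp add: that)
    also have "\<dots> = (\<integral>\<^sup>+x. h (a + x) \<partial>N)"
      using that(2,3) by (intro nn_integral_distr) (auto cong: measurable_cong_sets)
    finally show ?thesis ..
  qed
  have main: "emeasure M A = k * emeasure lborel A" if [measurable]: "A \<in> sets borel" for A
  proof -
    have in1: "(\<integral>\<^sup>+y. indicator A x * indicator B (y - x) \<partial>lborel) = indicator A x" for x
    proof -
      have "(\<integral>\<^sup>+y. indicator B (y - x) \<partial>lborel) = (\<integral>\<^sup>+y. indicator B y \<partial>lborel)"
        using shift[of lborel "-x" "indicator B"] by (simp add: lborel_distr_plus)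
      then show ?thesis by (simp add: nn_integral_cmult B1)
    qed
    \<comment> \<open>Invariance of \<open>M\<close> under translation by \<open>y\<close> replaces
      \<open>x\<close> by \<open>y + x\<close>. This removes \<open>y\<close> from the factor with
      \<open>B\<close>, so that integrating over \<open>y\<close> afterwards yields the Lebesgue
      measure of \<open>A\<close>.\<close>
    have in2: "(\<integral>\<^sup>+x. indicator A x * indicator B (y - x) \<partial>M)
        = (\<integral>\<^sup>+x. indicator A (y + x) * indicator B (- x) \<partial>M)" for y
      using shift[of M y "\<lambda>x. indicator A x * indicator B (y - x)"] inv by (simp add: sets_M)
    have in3: "(\<integral>\<^sup>+y. indicator A (y + x) * indicator B (- x) \<partial>lborel)
        = emeasure lborel A * indicator B (- x)" for x
    proof -
      have "(\<integral>\<^sup>+y. indicator A (y + x) \<partial>lborel) = (\<integral>\<^sup>+y. indicator A y \<partial>lborel)"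
        using shift[of lborel x "indicator A"] by (simp add: lborel_distr_plus add.commute)
      then show ?thesis by (simp add: nn_integral_multc)
    qed
    have "emeasure M A = (\<integral>\<^sup>+x. indicator A x \<partial>M)" by (simp add: sets_M)
    also have "\<dots> = (\<integral>\<^sup>+x. \<integral>\<^sup>+y. indicator A x * indicator B (y - x) \<partial>lborel \<partial>M)"
      by (simp add: in1)
    also have "\<dots> = (\<integral>\<^sup>+y. \<integral>\<^sup>+x. indicator A x * indicator B (y - x) \<partial>M \<partial>lborel)"
      by (rule P.Fubini'[symmetric]) measurable
    also have "\<dots> = (\<integral>\<^sup>+y. \<integral>\<^sup>+x. indicator A (y + x) * indicator B (- x) \<partial>M \<partial>lborel)"
      by (simp only: in2)
    also have "\<dots> = (\<integral>\<^sup>+x. \<integral>\<^sup>+y. indicator A (y + x) * indicator B (- x) \<partial>lborel \<partial>M)"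
      by (rule P.Fubini') measurable
    also have "\<dots> = (\<integral>\<^sup>+x. emeasure lborel A * indicator (uminus -` B) x \<partial>M)"
      by (simp only: in3) (simp add: indicator_def)
    also have "\<dots> = k * emeasure lborel A"
      by (simp add: nn_integral_cmult k_def sets_M mult.commute)
    finally show ?thesis .
  qed
  show ?thesis
  proof
    have "bounded (uminus -` B)"
    proof -
      have "uminus -` B = uminus ` B" by force
      then show ?thesis by (simp add: bounded_uminus B_def)
    qed
    then show "k < \<infinity>" unfolding k_def by (intro fin) auto
    show "M = density lborel (\<lambda>_. k)"
      by (rule measure_eqI) (auto simp: sets_M main emeasure_density nn_integral_cmult)
  qed
qed

section \<open>Comparison of Hausdorff measure and Lebesgue measure on the coordinate plane\<close>

lemma emeasure_lborel_rectangle: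
  "emeasure lborel ({a..b} \<times> {c..d}) = emeasure lborel {a..b} * emeasure lborel {c..d :: real}"
  for a b :: real
  unfolding lborel_prod[symmetric] by (rule lborel.emeasure_pair_measure_Times) auto

text \<open>A grid of \<open>N * N\<close> squares of side \<open>h = 2 r / N\<close> costs at most
  \<open>pi h^2\<close> per square, since each has diameter at most \<open>2 h\<close>. The total
  \<open>pi (N h)^2\<close> is the same at every scale.\<close>

lemma area_outer_square_finite:
  assumes "0 < r"
  shows "area_outer ({-r<..<r} \<times> {-r<..<r :: real}) \<le> ennreal (4 * pi * r\<^sup>2)"
proof (rule area_outer_least)
  fix \<delta> :: real assume "0 < \<delta>"
  \<comment> \<open>The factor 4 makes the diameter bound \<open>2 * h = 4 * r / N\<close> at most
    \<open>\<delta>\<close>.\<close>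
  obtain N :: nat where N: "4 * r / \<delta> < real N" using reals_Archimedean2 by blast
  then have N0: "0 < N"
    using assms \<open>0 < \<delta>\<close> by (metis divide_pos_pos mult_pos_pos not_gr_zero of_nat_0 order_less_trans less_irrefl zero_less_numeral)
  define h where "h = 2 * r / real N"
  have h: "0 < h" using assms N0 by (simp add: h_def)
  have hN: "real N * h = 2 * r" using N0 by (simp add: h_def)
  have h\<delta>: "2 * h \<le> \<delta>" using N N0 \<open>0 < \<delta>\<close> by (simp add: h_def field_simps)
  define Q where "Q i j = {- r + real i * h..- r + real i * h + h} \<times> {- r + real j * h..- r + real j * h + h}" for i j
  define C where "C i = (if i < N * N then Q (i div N) (i mod N) else {})" for i
  have Q: "bounded (Q i j)" "diameter (Q i j) \<le> 2 * h" for i j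
  proof -
    show "bounded (Q i j)" by (auto simp: Q_def intro: bounded_Times)
    show "diameter (Q i j) \<le> 2 * h"
    proof (rule diameter_le)
      fix x y assume "x \<in> Q i j" "y \<in> Q i j"
      then have "\<bar>fst x - fst y\<bar> \<le> h" "\<bar>snd x - snd y\<bar> \<le> h" by (auto simp: Q_def)
      moreover have "norm (x - y) \<le> norm (fst (x - y)) + norm (snd (x - y))"
        by (metis norm_Pair_le prod.collapse)
      ultimately show "norm (x - y) \<le> 2 * h" by simp
    qed (use h in auto)
  qed
  have idx: "\<exists>i<N. t \<in> {- r + real i * h..- r + real i * h + h}" if "t \<in> {-r<..<r}" for t
  proof (intro exI conjI)
    let ?i = "nat \<lfloor>(t + r) / h\<rfloor>"
    have t: "0 \<le> (t + r) / h" "(t + r) / h < real N"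
      using that h hN by (auto simp: field_simps)
    then have i: "real ?i \<le> (t + r) / h" "(t + r) / h < real ?i + 1"
      by (auto simp: of_nat_nat)
    then show "?i < N" using t by linarith
    show "t \<in> {- r + real ?i * h..- r + real ?i * h + h}"
      using i h by (auto simp: field_simps)
  qed
  have "fine_cover \<delta> ({-r<..<r} \<times> {-r<..<r}) C"
  proof (intro conjI allI subsetI)
    fix x assume "x \<in> {-r<..<r} \<times> {-r<..<r}"
    then obtain i j where ij: "i < N" "j < N" "x \<in> Q i j"
      using idx[of "fst x"] idx[of "snd x"] by (auto simp: Q_def)
    have "i * N + j < Suc i * N" using ij by simp
    also have "\<dots> \<le> N * N" using ij by (intro mult_le_mono1) simp
    finally have "i * N + j < N * N" .
    then have "x \<in> C (i * N + j)" using ij by (simp add: C_def)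
    then show "x \<in> (\<Union>i. C i)" by blast
  next
    fix i show "bounded (C i)" "diameter (C i) \<le> \<delta>"
      using Q[of "i div N" "i mod N"] h\<delta> \<open>0 < \<delta>\<close> by (auto simp: C_def)
  qed
  then have "area_premeasure \<delta> ({-r<..<r} \<times> {-r<..<r}) \<le> (\<Sum>i. disc_area (C i))"
    by (rule area_premeasure_le)
  also have "\<dots> = (\<Sum>i<N * N. disc_area (C i))"
    by (rule suminf_finite) (auto simp: C_def)
  also have "\<dots> \<le> (\<Sum>i<N * N. ennreal (pi * h\<^sup>2))"
  proof (intro sum_mono ennreal_leI mult_left_mono power_mono)
    fix i show "diameter (C i) / 2 \<le> h" "0 \<le> diameter (C i) / 2"
      using Q[of "i div N" "i mod N"] h by (auto simp: C_def diameter_ge_0)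
  qed auto
  also have "\<dots> = ennreal (real N * real N * (pi * h\<^sup>2))"
    by (simp add: ennreal_of_nat_eq_real_of_nat ennreal_mult[symmetric])
  also have "real N * real N * (pi * h\<^sup>2) = pi * (real N * h)\<^sup>2"
    by (simp add: power2_eq_square algebra_simps)
  also have "\<dots> = 4 * pi * r\<^sup>2" unfolding hN by (simp add: power2_eq_square)
  finally show "area_premeasure \<delta> ({-r<..<r} \<times> {-r<..<r}) \<le> ennreal (4 * pi * r\<^sup>2)" .
qed

text \<open>A set of diameter \<open>d\<close> lies in a square of side \<open>2 d\<close>, whose
  Lebesgue measure \<open>4 d^2\<close> is \<open>16 / pi\<close> times the disc area of the set;
  such squares cover a set of measure 1. This excludes the zero multiple of Lebesgue
  measure.\<close>

lemma area_premeasure_unit_square: "ennreal (pi / 16) \<le> area_premeasure \<delta> ({0..1 :: real} \<times> {0..1 :: real})"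
proof (rule area_premeasure_greatest)
  fix C assume C: "fine_cover \<delta> ({0..1 :: real} \<times> {0..1 :: real}) C"
  define D where "D i = (if C i = {} then {} else
      (let x = SOME x. x \<in> C i; d = diameter (C i) in {fst x - d..fst x + d} \<times> {snd x - d..snd x + d}))" for i
  have CD: "C i \<subseteq> D i" for i
  proof
    fix y assume y: "y \<in> C i"
    define x where "x = (SOME x. x \<in> C i)"
    have "x \<in> C i" unfolding x_def by (rule someI) (rule y)
    then have "dist x y \<le> diameter (C i)" using C y by (intro diameter_bounded_bound) auto
    then have "dist (fst x) (fst y) \<le> diameter (C i)" "dist (snd x) (snd y) \<le> diameter (C i)"
      by (meson dist_fst_le dist_snd_le order_trans)+
    then have "y \<in> {fst x - diameter (C i)..fst x + diameter (C i)} \<times> {snd x - diameter (C i)..snd x + diameter (C i)}"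
      by (cases y) (auto simp: dist_real_def)
    then show "y \<in> D i" using y by (auto simp: D_def x_def Let_def)
  qed
  have [measurable]: "D i \<in> sets borel" for i
    by (auto simp: D_def Let_def intro!: borel_closed closed_Times)
  have D: "emeasure lborel (D i) \<le> ennreal (16 / pi) * disc_area (C i)" for i
  proof -
    have "0 \<le> diameter (C i)" using C by (simp add: diameter_ge_0)
    then have "emeasure lborel (D i) \<le> ennreal (2 * diameter (C i)) * ennreal (2 * diameter (C i))"
      by (simp add: D_def Let_def emeasure_lborel_rectangle)
    also have "\<dots> = ennreal (16 / pi) * disc_area (C i)"
      using \<open>0 \<le> diameter (C i)\<close> by (simp add: ennreal_mult[symmetric] power2_eq_square)
    finally show ?thesis .
  qed
  have "1 = emeasure lborel ({0..1 :: real} \<times> {0..1 :: real})"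
    by (simp add: emeasure_lborel_rectangle)
  also have "\<dots> \<le> emeasure lborel (\<Union>i. D i)"
  proof (rule emeasure_mono)
    have "{0..1 :: real} \<times> {0..1 :: real} \<subseteq> (\<Union>i. C i)" using C by blast
    then show "{0..1 :: real} \<times> {0..1 :: real} \<subseteq> (\<Union>i. D i)" using CD by blast
  qed simp
  also have "\<dots> \<le> (\<Sum>i. emeasure lborel (D i))"
    by (rule emeasure_subadditive_countably) auto
  also have "\<dots> \<le> (\<Sum>i. ennreal (16 / pi) * disc_area (C i))"
    by (intro suminf_le D) auto
  also have "\<dots> = ennreal (16 / pi) * (\<Sum>i. disc_area (C i))"
    by (rule ennreal_suminf_cmult)
  finally have "ennreal (pi / 16) * 1 \<le> ennreal (pi / 16) * (ennreal (16 / pi) * (\<Sum>i. disc_area (C i)))"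
    by (rule mult_left_mono) simp
  then show "ennreal (pi / 16) \<le> (\<Sum>i. disc_area (C i))"
    by (simp add: mult.assoc[symmetric] ennreal_mult[symmetric])
qed

text \<open>The value of the constant, which is 1 by the isodiametric inequality, is irrelevant for
  averages.\<close>

lemma area_measure_plane:
  obtains \<kappa> where "0 < \<kappa>" "\<kappa> < \<infinity>" "(area_measure :: (real \<times> real) measure) = density lborel (\<lambda>_. \<kappa>)"
proof -
  let ?M = "area_measure :: (real \<times> real) measure"
  obtain k where k: "k < \<infinity>" "?M = density lborel (\<lambda>_. k)"
  proof (rule translation_invariant_eq_lborel[of ?M])
    show "distr ?M borel ((+) a) = ?M" for a
      using distr_area_measure_isometry[of "(+) a"] by (simp add: density_one)
    fix A :: "(real \<times> real) set" assume A: "A \<in> sets borel" "bounded A"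
    then obtain r where r: "0 < r" "A \<subseteq> ball 0 r"
      by (metis bounded_subset_ballD)
    have "A \<subseteq> {-r<..<r} \<times> {-r<..<r}"
    proof
      fix y assume "y \<in> A"
      then have "dist 0 y < r" using r by auto
      then have "dist 0 (fst y) < r" "dist 0 (snd y) < r"
        using dist_fst_le[of 0 y] dist_snd_le[of 0 y] by auto
      then show "y \<in> {-r<..<r} \<times> {-r<..<r}" by (cases y) (auto simp: dist_real_def)
    qed
    then have "area_outer A \<le> ennreal (4 * pi * r\<^sup>2)"
      using area_outer_square_finite[OF r(1)] by (meson area_outer_mono order_trans)
    then show "emeasure ?M A < \<infinity>"
      using A by (simp add: emeasure_area_measure le_less_trans)
  qed (auto intro: that)
  let ?Q = "{0..1 :: real} \<times> {0..1 :: real} :: (real \<times> real) set"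
  have Q: "?Q \<in> sets borel" by (intro borel_closed closed_Times) auto
  have "0 < ennreal (pi / 16)" by simp
  also have "\<dots> \<le> area_premeasure 1 ?Q" by (rule area_premeasure_unit_square)
  also have "\<dots> \<le> area_outer ?Q" by (rule area_premeasure_le_outer) simp
  also have "\<dots> = emeasure ?M ?Q" by (simp add: emeasure_area_measure Q)
  also have "\<dots> = k"
    using Q by (simp add: k(2) emeasure_density nn_integral_cmult emeasure_lborel_rectangle)
  finally show ?thesis using k that by blast
qed

section \<open>Isometries and convex functions\<close>

text \<open>Translating by \<open>a\<close> in the target amounts to translating by
  \<open>K a\<close> in the source, so the push-forward of Lebesgue measure is translation
  invariant. The unspecified \<open>k\<close> stands for the reciprocal of a Jacobian determinant
  between two possibly different types.\<close>

lemma distr_lborel_affine_eq: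
  fixes L :: "'a::euclidean_space \<Rightarrow> 'b::euclidean_space"
  assumes L: "linear L" and K: "linear K" and KL: "\<And>x. K (L x) = x" and LK: "\<And>y. L (K y) = y"
  obtains k where "k < \<infinity>" "distr lborel borel (\<lambda>x. c + L x) = density lborel (\<lambda>_. k)"
proof (rule translation_invariant_eq_lborel)
  have [measurable]: "L \<in> borel_measurable borel" "K \<in> borel_measurable borel"
    using L K by (auto intro!: borel_measurable_continuous_onI linear_continuous_on
        simp: linear_conv_bounded_linear)
  let ?h = "\<lambda>x. c + L x"
  show "distr (distr lborel borel ?h) borel ((+) a) = distr lborel borel ?h" for a
  proof -
    have "distr (distr lborel borel ?h) borel ((+) a) = distr lborel borel (\<lambda>x. a + ?h x)"
      by (simp add: distr_distr comp_def)
    also have "(\<lambda>x. a + ?h x) = (\<lambda>x. ?h (K a + x))"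
      using linear_add[OF L] LK by (simp add: add_ac)
    also have "distr lborel borel (\<lambda>x. ?h (K a + x)) = distr (distr lborel borel ((+) (K a))) borel ?h"
      by (simp add: distr_distr comp_def)
    also have "\<dots> = distr lborel borel ?h"
      by (simp add: lborel_distr_plus)
    finally show ?thesis .
  qed
  fix A :: "'b set" assume A: "A \<in> sets borel" "bounded A"
  have "?h -` A = K ` ((+) (- c) ` A)"
  proof (intro equalityI subsetI)
    fix x assume "x \<in> ?h -` A"
    then have "c + L x \<in> A" "x = K (- c + (c + L x))" by (auto simp: KL)
    then show "x \<in> K ` ((+) (- c) ` A)" by blast
  qed (auto simp: LK)
  then have "bounded (?h -` A)"
    using bounded_linear_image[OF bounded_translation[OF A(2), of "- c"]] K
    by (simp only: linear_conv_bounded_linear)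
  then show "emeasure (distr lborel borel ?h) A < \<infinity>"
    using A(1) emeasure_bounded_finite[of "?h -` A"] by (simp add: emeasure_distr)
qed auto

lemma isometry_eq_orthogonal:
  fixes g :: "'a::euclidean_space \<Rightarrow> 'a"
  assumes "\<And>x y. dist (g x) (g y) = dist x y"
  obtains T where "orthogonal_transformation T" "\<And>x. g x = g 0 + T x"
proof
  show "orthogonal_transformation (\<lambda>x. g x - g 0)"
    unfolding orthogonal_transformation_isometry using assms by (simp add: dist_norm)
qed simp

lemma isometry_surj:
  fixes g :: "'a::euclidean_space \<Rightarrow> 'a"
  assumes "\<And>x y. dist (g x) (g y) = dist x y"
  shows "surj g"
proof -
  obtain T where T: "orthogonal_transformation T" "\<And>x. g x = g 0 + T x"
    using isometry_eq_orthogonal[OF assms] by metis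
  have "surj T"
    using T(1) by (simp add: linear_injective_imp_surjective orthogonal_transformation_inj orthogonal_transformation_linear)
  then have "\<exists>x. y = g x" for y by (metis T(2) add.commute diff_add_cancel surjD)
  then show ?thesis by (simp add: surj_def)
qed

lemma isometry_affine_combination:
  fixes g :: "'a::euclidean_space \<Rightarrow> 'a"
  assumes "\<And>x y. dist (g x) (g y) = dist x y"
  shows "g (c + t *\<^sub>R (y - c)) = g c + t *\<^sub>R (g y - g c)"
proof -
  obtain T where T: "orthogonal_transformation T" "\<And>x. g x = g 0 + T x"
    using isometry_eq_orthogonal[OF assms] by metis
  have L: "linear T" by (rule orthogonal_transformation_linear[OF T(1)])
  show ?thesis
    unfolding T(2)[of "c + _"] T(2)[of c] T(2)[of y]
    by (simp add: linear_add[OF L] linear_diff[OF L] linear_scale[OF L])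
qed

lemma emeasure_lborel_isometry_image:
  fixes g :: "'a::euclidean_space \<Rightarrow> 'a"
  assumes g: "\<And>x y. dist (g x) (g y) = dist x y" and A: "A \<in> sets borel" "g ` A \<in> sets borel"
  shows "emeasure lborel (g ` A) = emeasure lborel A"
proof -
  obtain T where T: "orthogonal_transformation T" "\<And>x. g x = g 0 + T x"
    using isometry_eq_orthogonal[OF g] by metis
  have L: "linear T" by (rule orthogonal_transformation_linear[OF T(1)])
  have bij: "bij T"
    using L T(1) by (simp add: bij_def linear_injective_imp_surjective orthogonal_transformation_inj)
  have "linear (inv T)" by (simp add: inj_linear_imp_inv_linear L bij bij_is_inj)
  then obtain k where k: "k < \<infinity>" "distr lborel borel (\<lambda>x. g 0 + T x) = density lborel (\<lambda>_. k)"
  proof (rule distr_lborel_affine_eq[OF L])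
    show "inv T (T x) = x" "T (inv T x) = x" for x
      using bij by (simp_all add: bij_is_inj bij_is_surj surj_f_inv_f)
  qed
  have [measurable]: "g \<in> borel_measurable borel"
    by (rule borel_measurable_continuous_onI) (rule continuous_on_isometry[OF g])
  have eq: "emeasure lborel (g -` B) = k * emeasure lborel B" if [measurable]: "B \<in> sets borel" for B
  proof -
    have "emeasure (distr lborel borel g) B = emeasure (density lborel (\<lambda>_. k)) B"
      using k(2) by (simp add: T(2)[symmetric])
    then show ?thesis by (simp add: emeasure_distr emeasure_density nn_integral_cmult)
  qed
  \<comment> \<open>The preimage of the unit ball around \<open>g 0\<close> is the unit ball around
    0. Both have the same positive finite volume, which forces \<open>k = 1\<close>.\<close>
  have "g -` ball (g 0) 1 = ball 0 1" by (auto simp: g)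
  then have "emeasure lborel (ball (0::'a) 1) = k * emeasure lborel (ball (g 0) 1)"
    using eq[of "ball (g 0) 1"] by simp
  then have "ennreal (unit_ball_vol (real DIM('a))) = k * ennreal (unit_ball_vol (real DIM('a)))"
    by (simp add: emeasure_ball)
  moreover have "0 < unit_ball_vol (real DIM('a))" by simp
  ultimately have "k = 1"
    using k(1) by (cases k) (auto simp: ennreal_mult[symmetric] simp flip: ennreal_1)
  moreover have "g -` (g ` A) = A"
  proof -
    have "inj g" using g by (metis dist_eq_0_iff injI)
    then show ?thesis by (rule inj_vimage_image_eq)
  qed
  ultimately show ?thesis using eq[OF A(2)] by simp
qed

section \<open>Regularity, bounds and supporting hyperplanes of convex functions\<close>

text \<open>Composition with an affine retraction \<open>\<pi>\<close> onto the affine hull turns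
  \<open>f\<close> into a convex function on an open subset of the whole space, where convexity
  implies continuity.\<close>

lemma convex_on_continuous_rel_interior:
  fixes f :: "'a::euclidean_space \<Rightarrow> real"
  assumes f: "convex_on S f"
  shows "continuous_on (rel_interior S) f"
proof (cases "S = {}")
  case False
  then obtain a where a: "a \<in> affine hull S" by (meson all_not_in_conv hull_inc)
  define V where "V = (+) (- a) ` (affine hull S)"
  have "subspace V" unfolding V_def
    by (rule affine_diffs_subspace[OF affine_affine_hull a])
  \<comment> \<open>A left inverse of the identity on \<open>V\<close> with range in
    \<open>V\<close> is a linear projection onto \<open>V\<close>.\<close>
  then obtain \<pi>' where \<pi>': "range \<pi>' \<subseteq> V" "linear \<pi>'" "\<And>v. v \<in> V \<Longrightarrow> \<pi>' v = v"
    using linear_exists_left_inverse_on[OF linear_id, of V] by auto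
  define \<pi> where "\<pi> x = a + \<pi>' (x - a)" for x
  have \<pi>_aff: "\<pi> x \<in> affine hull S" for x
  proof -
    have "\<pi>' (x - a) \<in> V" using \<pi>'(1) by blast
    then show ?thesis by (auto simp: \<pi>_def V_def)
  qed
  have \<pi>_id: "\<pi> x = x" if "x \<in> affine hull S" for x
  proof -
    have "x - a \<in> V" using that by (auto simp: V_def image_iff intro!: bexI[of _ x])
    then show ?thesis by (simp add: \<pi>_def \<pi>'(3))
  qed
  have \<pi>_comb: "\<pi> (u *\<^sub>R x + v *\<^sub>R y) = u *\<^sub>R \<pi> x + v *\<^sub>R \<pi> y" if "u + v = 1" for u v x y
  proof -
    have "v = 1 - u" using that by simp
    show ?thesis unfolding \<open>v = 1 - u\<close>
      by (simp add: \<pi>_def linear_add[OF \<pi>'(2)] linear_diff[OF \<pi>'(2)] linear_scale[OF \<pi>'(2)] algebra_simps)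
  qed
  let ?R = "rel_interior S"
  have fR: "convex_on ?R f"
    using convex_on_subset[OF f rel_interior_subset convex_rel_interior] f by (simp add: convex_on_def)
  have cont: "continuous_on UNIV \<pi>'" using \<pi>'(2) by (simp add: linear_continuous_on linear_conv_bounded_linear)
  have "continuous_on UNIV \<pi>"
    unfolding \<pi>_def
    by (intro continuous_on_add continuous_on_const continuous_on_compose2[OF cont]
        continuous_on_diff continuous_on_id subset_UNIV)
  moreover obtain T where T: "open T" "?R = affine hull S \<inter> T"
    using openin_rel_interior[of S] by (auto simp: openin_open)
  ultimately have "open (\<pi> -` T)" by (simp add: open_vimage)
  moreover have "\<pi> -` T = \<pi> -` ?R" using T(2) \<pi>_aff by auto
  ultimately have "open (\<pi> -` ?R)" by simp
  moreover have "convex_on (\<pi> -` ?R) (f \<circ> \<pi>)"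
    using fR by (auto simp: convex_on_def convex_def \<pi>_comb)
  ultimately have "continuous_on (\<pi> -` ?R) (f \<circ> \<pi>)" by (rule convex_on_continuous)
  moreover have sub: "\<pi> x = x" if "x \<in> ?R" for x using that T(2) \<pi>_id by auto
  moreover have "?R \<subseteq> \<pi> -` ?R" using sub by auto
  ultimately have "continuous_on ?R (f \<circ> \<pi>)" by (metis continuous_on_subset)
  then show ?thesis by (rule continuous_on_eq) (simp add: sub)
qed auto

lemma rel_interior_borel: "rel_interior S \<in> sets borel" for S :: "'a::euclidean_space set"
proof -
  obtain T where "open T" "rel_interior S = affine hull S \<inter> T"
    using openin_rel_interior[of S] by (auto simp: openin_open)
  then show ?thesis by (simp add: closed_affine_hull borel_closed borel_open sets.Int)
qed

text \<open>Induction on the dimension. On the relative interior \<open>f\<close> is continuous; the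
  rest of \<open>P\<close> is a finite union of facets, which are polytopes of smaller dimension on
  which \<open>f\<close> is again convex.\<close>

lemma convex_on_polytope_borel_measurable:
  fixes f :: "'a::euclidean_space \<Rightarrow> real"
  assumes "polytope P" "convex_on P f"
  shows "(\<lambda>x. indicator P x * f x) \<in> borel_measurable borel"
  using assms
proof (induction "nat (aff_dim P + 1)" arbitrary: P rule: less_induct)
  case less
  have P: "P = rel_interior P \<union> \<Union> {F. F facet_of P}"
    using rel_boundary_of_polyhedron[OF polytope_imp_polyhedron[OF less.prems(1)]] rel_interior_subset
    by blast
  show ?case
  proof (rule measurable_piecewise_restrict)
    let ?\<C> = "{rel_interior P, - P} \<union> {F. F facet_of P}"
    show "countable ?\<C>"
      using finite_polytope_facets[OF less.prems(1)] by (simp add: countable_finite)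
    show "space borel \<subseteq> \<Union> ?\<C>" using P by auto
    fix C assume C: "C \<in> ?\<C>"
    have closed: "closed P" using less.prems(1) by (rule polytope_imp_closed)
    from C consider "C = rel_interior P" | "C = - P" | "C facet_of P" by blast
    then have "C \<inter> space borel \<in> sets borel \<and> (\<lambda>x. indicator P x * f x) \<in> borel_measurable (restrict_space borel C)"
    proof cases
      case 1
      have "continuous_on (rel_interior P) (\<lambda>x. indicator P x * f x)"
        using convex_on_continuous_rel_interior[OF less.prems(2)]
        by (rule continuous_on_eq) (use subsetD[OF rel_interior_subset[of P]] in simp)
      then show ?thesis using 1
        using rel_interior_borel by (auto intro: borel_measurable_continuous_on_restrict)
    next
      case 2
      then have "(\<lambda>x. indicator P x * f x) \<in> borel_measurable (restrict_space borel C) \<longleftrightarrow>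
          (\<lambda>x. 0::real) \<in> borel_measurable (restrict_space borel C)"
        by (intro measurable_cong) (auto simp: space_restrict_space)
      then show ?thesis using 2 closed by auto
    next
      case 3
      have sub: "C \<subseteq> P" and face: "C face_of P" and dim: "aff_dim C = aff_dim P - 1" and "C \<noteq> {}"
        using 3 by (auto simp: facet_of_def face_of_imp_subset)
      have "polytope C" using face_of_polytope_polytope less.prems(1) face by blast
      moreover have "convex_on C f"
        using convex_on_subset less.prems(2) sub \<open>polytope C\<close> polytope_imp_convex by blast
      moreover have "nat (aff_dim C + 1) < nat (aff_dim P + 1)"
        using dim \<open>C \<noteq> {}\<close> aff_dim_geq[of C] aff_dim_empty[of C] by linarith
      ultimately have "(\<lambda>x. indicator C x * f x) \<in> borel_measurable borel"
        using less.hyps by blast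
      then have "(\<lambda>x. indicator C x * f x) \<in> borel_measurable (restrict_space borel C)"
        by (rule measurable_restrict_space1)
      moreover have "(\<lambda>x. indicator C x * f x) \<in> borel_measurable (restrict_space borel C) \<longleftrightarrow>
          (\<lambda>x. indicator P x * f x) \<in> borel_measurable (restrict_space borel C)"
        using sub by (intro measurable_cong) (auto simp: space_restrict_space indicator_def)
      ultimately show ?thesis using polytope_imp_closed[OF \<open>polytope C\<close>] by simp
    qed
    then show "C \<inter> space borel \<in> sets borel"
      and "(\<lambda>x. indicator P x * f x) \<in> borel_measurable (restrict_space borel C)" by auto
  qed
qed

text \<open>On the convex hull of finitely many points, a convex function is bounded by its largest
  value at these points.\<close>

lemma convex_on_polytope_bounded_above:
  assumes "polytope P" "convex_on P f"
  obtains b where "\<And>x. x \<in> P \<Longrightarrow> f x \<le> b"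
proof -
  obtain S where S: "finite S" "P = convex hull S" using assms(1) by (auto simp: polytope_def)
  have "\<forall>x\<in>S. f x \<le> Max (f ` S)" using S(1) by simp
  then show ?thesis
    using convex_on_convex_hull_bound[of S f] assms(2) S(2) that by blast
qed

text \<open>A hyperplane separating the strict epigraph from the point \<open>(c, f c)\<close> is
  the graph of an affine minorant, provided it is not vertical.\<close>

lemma convex_on_subgradient:
  fixes f :: "'a::euclidean_space \<Rightarrow> real"
  assumes f: "convex_on S f" and c: "c \<in> interior S"
  obtains w where "\<And>x. x \<in> S \<Longrightarrow> f c + w \<bullet> (x - c) \<le> f x"
proof -
  have cS: "c \<in> S" using c interior_subset by blast
  let ?E = "{(x, t). x \<in> S \<and> f x < t}"
  have "convex ?E"
  proof (rule convexI)
    fix p q :: "'a \<times> real" and u v :: real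
    assume pq: "p \<in> ?E" "q \<in> ?E" and uv: "0 \<le> u" "0 \<le> v" "u + v = 1"
    obtain x s y t where [simp]: "p = (x, s)" "q = (y, t)" by fastforce
    have *: "x \<in> S" "y \<in> S" "f x < s" "f y < t" using pq by auto
    have "f (u *\<^sub>R x + v *\<^sub>R y) \<le> u * f x + v * f y"
      using f uv * by (simp add: convex_on_def)
    also have "\<dots> < u * s + v * t"
    proof (cases "u = 0")
      case True
      then show ?thesis using uv * by simp
    next
      case False
      then have "u * f x < u * s" "v * f y \<le> v * t" using uv * by (auto intro: mult_left_mono)
      then show ?thesis by linarith
    qed
    finally show "u *\<^sub>R p + v *\<^sub>R q \<in> ?E"
      using * uv convex_on_imp_convex[OF f] by (simp add: convex_def)
  qed
  moreover have "(c, f c + 1) \<in> ?E" using cS by simp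
  then have "?E \<noteq> {}" by blast
  moreover have "?E \<inter> {(c, f c)} = {}" by auto
  ultimately obtain a b where a: "a \<noteq> 0" "\<forall>z\<in>?E. a \<bullet> z \<le> b" "\<forall>z\<in>{(c, f c)}. b \<le> a \<bullet> z"
    using separating_hyperplane_sets[of ?E "{(c, f c)}"] by auto
  obtain p q where [simp]: "a = (p, q)" by fastforce
  have sep: "p \<bullet> x + q * t \<le> p \<bullet> c + q * f c" if "x \<in> S" "f x < t" for x t
    using a(2)[rule_format, of "(x, t)"] a(3) that by auto
  have "q \<le> 0" using sep[OF cS, of "f c + 1"] by (simp add: algebra_simps)
  \<comment> \<open>A vertical hyperplane would confine \<open>S\<close> to one side of a hyperplane
    through \<open>c\<close>, but a small step from the interior point \<open>c\<close> in direction
    \<open>p\<close> stays in \<open>S\<close> and crosses it.\<close>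
  moreover have "q \<noteq> 0"
  proof
    assume "q = 0"
    obtain e where e: "e > 0" "cball c e \<subseteq> S"
      using c by (meson mem_interior_cball)
    have "p \<noteq> 0" using a(1) \<open>q = 0\<close> by (auto simp: zero_prod_def)
    let ?x = "c + (e / norm p) *\<^sub>R p"
    have "?x \<in> cball c e" using e(1) \<open>p \<noteq> 0\<close> by (simp add: dist_norm)
    then have "?x \<in> S" using e(2) by blast
    from sep[OF this, of "f ?x + 1"] have "(e / norm p) * (p \<bullet> p) \<le> 0"
      using \<open>q = 0\<close> by (simp add: inner_add_right)
    moreover have "0 < (e / norm p) * (p \<bullet> p)"
      using e(1) \<open>p \<noteq> 0\<close> by simp
    ultimately show False by linarith
  qed
  ultimately have q: "q < 0" by simp
  show ?thesis
  proof
    fix x assume x: "x \<in> S"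
    \<comment> \<open>Separation speaks of the strict epigraph only, so the bound is first obtained
      for every \<open>t\<close> above \<open>f x\<close>.\<close>
    have "f c + ((- 1 / q) *\<^sub>R p) \<bullet> (x - c) \<le> t" if "f x < t" for t
      using sep[OF x that] q by (simp add: inner_diff_right field_simps)
    then show "f c + ((- 1 / q) *\<^sub>R p) \<bullet> (x - c) \<le> f x"
      by (rule dense_ge)
  qed
qed

text \<open>A subgradient at an interior point provides an affine minorant, and affine functions are
  bounded on bounded sets.\<close>

lemma convex_on_bounded_below:
  fixes f :: "'a::euclidean_space \<Rightarrow> real"
  assumes f: "convex_on S f" and "interior S \<noteq> {}" and "bounded S"
  obtains b where "\<And>x. x \<in> S \<Longrightarrow> b \<le> f x"
proof -
  obtain c where "c \<in> interior S" using assms(2) by blast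
  then obtain w where w: "\<And>x. x \<in> S \<Longrightarrow> f c + w \<bullet> (x - c) \<le> f x"
    using convex_on_subgradient[OF f] by metis
  obtain B where B: "\<And>x. x \<in> S \<Longrightarrow> norm x \<le> B" using assms(3) by (auto simp: bounded_iff)
  show ?thesis
  proof
    fix x assume x: "x \<in> S"
    have "\<bar>w \<bullet> (x - c)\<bar> \<le> norm w * norm (x - c)" by (rule Cauchy_Schwarz_ineq2)
    also have "\<dots> \<le> norm w * (B + norm c)"
      using B[OF x] norm_triangle_ineq4[of x c] by (intro mult_left_mono) auto
    finally show "f c - norm w * (B + norm c) \<le> f x" using w[OF x] by linarith
  qed
qed

section \<open>Polar coordinates over a plane\<close>

lemma aff_dim_injective_linear_image:
  fixes f :: "'a::euclidean_space \<Rightarrow> 'b::euclidean_space"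
  assumes "linear f" "inj f"
  shows "aff_dim (f ` S) = aff_dim S"
proof (cases "S = {}")
  case False
  then obtain a where a: "a \<in> S" by blast
  have "aff_dim (f ` S) = int (dim ((+) (- f a) ` f ` S))"
    using a by (intro aff_dim_eq_dim hull_inc) auto
  also have "(+) (- f a) ` f ` S = f ` ((+) (- a) ` S)"
    by (simp add: image_image linear_diff[OF assms(1)])
  also have "dim (f ` ((+) (- a) ` S)) = dim ((+) (- a) ` S)"
    by (rule dim_image_eq[OF assms(1)]) (use assms(2) inj_on_subset in blast)
  also have "int \<dots> = aff_dim S"
    using a by (intro aff_dim_eq_dim[symmetric] hull_inc)
  finally show ?thesis .
qed simp

lemma linear_borel_measurable:
  fixes L :: "'a::euclidean_space \<Rightarrow> 'b::euclidean_space"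
  shows "linear L \<Longrightarrow> L \<in> borel_measurable borel"
  by (auto intro!: borel_measurable_continuous_onI linear_continuous_on simp: linear_conv_bounded_linear)

lemma plane_chart:
  fixes P :: "'a::euclidean_space set"
  assumes "affine P" "aff_dim P = 2"
  obtains p and \<psi> :: "real \<times> real \<Rightarrow> 'a"
  where "linear \<psi>" "\<And>u. norm (\<psi> u) = norm u" "P = range (\<lambda>u. p + \<psi> u)"
proof -
  obtain p where p: "p \<in> P" using assms(2) by fastforce
  define V where "V = (+) (- p) ` P"
  have sub: "subspace V" unfolding V_def by (rule affine_diffs_subspace[OF assms(1) p])
  have "p \<in> affine hull P" using p by (simp add: hull_inc)
  from aff_dim_eq_dim[OF this] have "dim V = 2" using assms(2) by (simp add: V_def)
  then have "dim (UNIV :: (real \<times> real) set) = dim V" by simp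
  from isometries_subspaces[OF subspace_UNIV sub this]
  obtain f :: "real \<times> real \<Rightarrow> 'a"
    where f: "linear f" "f ` UNIV = V" "\<And>x. norm (f x) = norm x"
    by (metis UNIV_I)
  have "P = (\<lambda>v. p + v) ` V" by (simp add: V_def image_image)
  then have "P = range (\<lambda>u. p + f u)" by (simp add: f(2)[symmetric] image_image)
  with f show ?thesis using that by blast
qed

context
  fixes P :: "'a::euclidean_space set" and p :: 'a and \<psi> :: "real \<times> real \<Rightarrow> 'a"
  assumes lin: "linear \<psi>" and norm_\<psi>: "\<And>u. norm (\<psi> u) = norm u" and P: "P = range (\<lambda>u. p + \<psi> u)"
begin

lemma plane_chart_isometry: "dist (p + \<psi> u) (p + \<psi> v) = dist u v"
  using norm_\<psi>[of "u - v"] by (simp add: dist_norm linear_diff[OF lin])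

lemma plane_chart_inj: "inj \<psi>"
  using plane_chart_isometry by (metis dist_eq_0_iff injI)

lemma plane_chart_range_borel: "P \<in> sets borel"
proof -
  have "subspace (range \<psi>)" by (rule linear_subspace_image[OF lin subspace_UNIV])
  then have "closed ((+) p ` range \<psi>)" by (intro closed_translation closed_subspace)
  then show ?thesis by (simp add: P image_image borel_closed)
qed

text \<open>Area on \<open>P\<close> is the push-forward under the chart of area on
  \<open>real \<times> real\<close>, which is \<open>\<kappa>\<close> times Lebesgue
  measure.\<close>

lemma plane_chart_nn_integral:
  assumes \<kappa>: "(area_measure :: (real \<times> real) measure) = density lborel (\<lambda>_. \<kappa>)"
    and h [measurable]: "h \<in> borel_measurable borel"
  shows "(\<integral>\<^sup>+y. h y * indicator P y \<partial>area_measure) = \<kappa> * (\<integral>\<^sup>+u. h (p + \<psi> u) \<partial>lborel)"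
proof -
  note plane_chart_range_borel[measurable] linear_borel_measurable[OF lin, measurable]
  have "(\<integral>\<^sup>+y. h y * indicator P y \<partial>area_measure) = (\<integral>\<^sup>+y. h y \<partial>density area_measure (indicator P))"
    by (simp add: nn_integral_density mult.commute)
  also have "density area_measure (indicator P) = distr area_measure borel (\<lambda>u. p + \<psi> u)"
    unfolding P
    by (rule distr_area_measure_isometry[OF plane_chart_isometry, symmetric])
      (use plane_chart_range_borel P in simp)
  also have "(\<integral>\<^sup>+y. h y \<partial>distr area_measure borel (\<lambda>u. p + \<psi> u)) = (\<integral>\<^sup>+u. h (p + \<psi> u) \<partial>area_measure)"
    by (rule nn_integral_distr) auto
  also have "\<dots> = \<kappa> * (\<integral>\<^sup>+u. h (p + \<psi> u) \<partial>lborel)"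
    unfolding \<kappa> by (simp add: nn_integral_density nn_integral_cmult)
  finally show ?thesis .
qed

lemma plane_chart_emeasure:
  assumes \<kappa>: "(area_measure :: (real \<times> real) measure) = density lborel (\<lambda>_. \<kappa>)"
    and A [measurable]: "A \<in> sets borel" and "A \<subseteq> P"
  shows "emeasure area_measure A = \<kappa> * emeasure lborel ((\<lambda>u. p + \<psi> u) -` A)"
proof -
  note linear_borel_measurable[OF lin, measurable]
  have [measurable]: "(\<lambda>u. p + \<psi> u) -` A \<in> sets borel"
    using measurable_sets[of "\<lambda>u. p + \<psi> u" borel borel A] by simp
  have "emeasure area_measure A = (\<integral>\<^sup>+y. indicator A y * indicator P y \<partial>area_measure)"
    using \<open>A \<subseteq> P\<close> by (subst indicator_inter_arith[symmetric]) (simp add: Int_absorb2)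
  also have "\<dots> = \<kappa> * (\<integral>\<^sup>+u. indicator A (p + \<psi> u) \<partial>lborel)"
    by (rule plane_chart_nn_integral[OF \<kappa>]) simp
  also have "(\<lambda>u. indicator A (p + \<psi> u)) = (indicator ((\<lambda>u. p + \<psi> u) -` A) :: _ \<Rightarrow> ennreal)"
    by (auto simp: indicator_def fun_eq_iff)
  finally show ?thesis by simp
qed

lemma plane_chart_convex_vimage:
  assumes "convex Z" "Z \<subseteq> P"
  shows "convex ((\<lambda>u. p + \<psi> u) -` Z)" "aff_dim ((\<lambda>u. p + \<psi> u) -` Z) = aff_dim Z"
proof -
  have "(\<lambda>u. p + \<psi> u) -` Z = \<psi> -` ((+) (- p) ` Z)"
    by (force simp: image_iff)
  then show "convex ((\<lambda>u. p + \<psi> u) -` Z)"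
    using assms lin by (simp only: convex_linear_vimage convex_translation)
  have "Z = (+) p ` \<psi> ` ((\<lambda>u. p + \<psi> u) -` Z)"
    using assms(2) P by auto
  then have "aff_dim Z = aff_dim ((+) p ` \<psi> ` ((\<lambda>u. p + \<psi> u) -` Z))" by simp
  then show "aff_dim ((\<lambda>u. p + \<psi> u) -` Z) = aff_dim Z"
    using aff_dim_injective_linear_image[OF lin plane_chart_inj] by (simp only: aff_dim_translation_eq)
qed

end

text \<open>In a chart \<open>Z\<close> becomes a convex set of dimension below 2, hence without
  interior points, hence negligible. It is meant for the intersection of two facets.\<close>

lemma area_measure_convex_lowdim:
  fixes Z :: "'a::euclidean_space set"
  assumes "affine P" "aff_dim P = 2" "Z \<subseteq> P" "convex Z" "Z \<in> sets borel" "aff_dim Z < 2"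
  shows "emeasure area_measure Z = 0"
proof -
  obtain p and \<psi> :: "real \<times> real \<Rightarrow> 'a"
    where chart: "linear \<psi>" "\<And>u. norm (\<psi> u) = norm u" "P = range (\<lambda>u. p + \<psi> u)"
    using plane_chart[OF assms(1,2)] by metis
  obtain \<kappa> where \<kappa>: "(area_measure :: (real \<times> real) measure) = density lborel (\<lambda>_. \<kappa>)"
    using area_measure_plane by metis
  note linear_borel_measurable[OF chart(1), measurable] assms(5)[measurable]
  let ?Z = "(\<lambda>u. p + \<psi> u) -` Z"
  have Z: "?Z \<in> sets borel"
    using measurable_sets[of "\<lambda>u. p + \<psi> u" borel borel Z] by simp
  note v = plane_chart_convex_vimage[OF chart assms(4,3)]
  have "interior ?Z = {}"
    using aff_dim_nonempty_interior[of ?Z] v(2) assms(6) by fastforce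
  then have "negligible ?Z" using v(1) by (simp add: negligible_convex_interior)
  then have "emeasure lborel ?Z = 0"
    using Z by (simp add: negligible_iff_null_sets null_sets_completion_iff null_setsD1)
  then show ?thesis
    using plane_chart_emeasure[OF chart \<kappa> assms(5,3)] by simp
qed

text \<open>In a chart of its affine hull, \<open>F\<close> has full dimension, hence interior
  points and positive Lebesgue measure; boundedness gives finiteness.\<close>

lemma area_measure_convex_body:
  fixes F :: "'a::euclidean_space set"
  assumes "convex F" "compact F" "aff_dim F = 2"
  shows "0 < emeasure area_measure F" "emeasure area_measure F < \<infinity>"
proof -
  define P where "P = affine hull F"
  have P: "affine P" "aff_dim P = 2" "F \<subseteq> P" using assms by (auto simp: P_def hull_subset)
  have F: "F \<in> sets borel" using assms by (simp add: borel_closed compact_imp_closed)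
  obtain p and \<psi> :: "real \<times> real \<Rightarrow> 'a"
    where chart: "linear \<psi>" "\<And>u. norm (\<psi> u) = norm u" "P = range (\<lambda>u. p + \<psi> u)"
    using plane_chart[OF P(1,2)] by metis
  obtain \<kappa> where \<kappa>: "0 < \<kappa>" "\<kappa> < \<infinity>" "(area_measure :: (real \<times> real) measure) = density lborel (\<lambda>_. \<kappa>)"
    using area_measure_plane by metis
  note linear_borel_measurable[OF chart(1), measurable] F[measurable]
  let ?\<phi> = "\<lambda>u. p + \<psi> u"
  let ?F = "?\<phi> -` F"
  have F': "?F \<in> sets borel"
    using measurable_sets[of ?\<phi> borel borel F] by simp
  note v = plane_chart_convex_vimage[OF chart assms(1) P(3)]
  have iso: "dist (?\<phi> u) (?\<phi> w) = dist u w" for u w by (rule plane_chart_isometry[OF chart])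
  have "?\<phi> ` ?F \<subseteq> F" by blast
  then have "bounded (?\<phi> ` ?F)" by (rule bounded_subset[OF compact_imp_bounded[OF assms(2)]])
  then have "bounded ?F" by (simp only: bounded_isometry_image_iff[OF iso])
  then have fin: "emeasure lborel ?F < \<infinity>" by (rule emeasure_bounded_finite)
  have "aff_dim ?F = int DIM(real \<times> real)" using v(2) assms(3) by simp
  then have "affine hull ?F = UNIV" by (simp only: aff_dim_eq_full)
  then have "interior ?F = rel_interior ?F" by (simp add: rel_interior_interior)
  moreover have "?F \<noteq> {}" using v(2) assms(3) by fastforce
  ultimately have "interior ?F \<noteq> {}" using v(1) by (simp add: rel_interior_eq_empty)
  then have "\<not> negligible ?F" using v(1) by (simp add: negligible_convex_interior)
  then have "emeasure lborel ?F \<noteq> 0"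
    using F' by (simp add: negligible_iff_null_sets null_sets_completion_iff null_sets_def)
  then show "0 < emeasure area_measure F" "emeasure area_measure F < \<infinity>"
    using plane_chart_emeasure[OF chart \<kappa>(3) F P(3)] fin \<kappa>(1,2)
    by (auto simp: ennreal_zero_less_mult_iff zero_less_iff_neq_zero ennreal_mult_less_top)
qed

section \<open>Cones over planar sets and their polar coordinates\<close>

text \<open>The apex is left out, so that over a subset of a plane missing \<open>c\<close> every
  point of the cone determines its \<open>t\<close> and \<open>y\<close>.\<close>

definition cone_over :: "'a::real_vector \<Rightarrow> 'a set \<Rightarrow> 'a set" where
  "cone_over c A = {c + t *\<^sub>R (y - c) |t y. 0 < t \<and> t \<le> 1 \<and> y \<in> A}"

text \<open>The Jacobian \<open>s^2\<close> of a dilation of the plane is the origin of the weight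
  \<open>t^2\<close> in polar coordinates.\<close>

lemma nn_integral_lborel_scale_plane:
  fixes f :: "real \<times> real \<Rightarrow> ennreal"
  assumes [measurable]: "f \<in> borel_measurable borel" and "0 < s"
  shows "(\<integral>\<^sup>+u. f u \<partial>lborel) = ennreal (s\<^sup>2) * (\<integral>\<^sup>+u. f (s *\<^sub>R u) \<partial>lborel)"
proof -
  have "(lborel :: (real \<times> real) measure) = density (distr lborel borel (\<lambda>x. s *\<^sub>R x)) (\<lambda>_. ennreal (s\<^sup>2))"
    using lborel_affine[of s "0 :: real \<times> real"] \<open>0 < s\<close> by (simp add: power2_eq_square)
  then have "(\<integral>\<^sup>+u. f u \<partial>lborel)
      = (\<integral>\<^sup>+u. f u \<partial>density (distr lborel borel (\<lambda>x. s *\<^sub>R x)) (\<lambda>_. ennreal (s\<^sup>2)))" by simp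
  also have "\<dots> = ennreal (s\<^sup>2) * (\<integral>\<^sup>+u. f (s *\<^sub>R u) \<partial>lborel)"
    by (simp add: nn_integral_density nn_integral_distr nn_integral_cmult)
  finally show ?thesis .
qed

lemma nn_integral_lborel_Pair:
  fixes G :: "'a::euclidean_space \<times> 'b::euclidean_space \<Rightarrow> ennreal"
  assumes "G \<in> borel_measurable borel"
  shows "(\<integral>\<^sup>+z. G z \<partial>lborel) = (\<integral>\<^sup>+s. (\<integral>\<^sup>+u. G (u, s) \<partial>lborel) \<partial>lborel)"
proof -
  have "G \<in> borel_measurable (lborel \<Otimes>\<^sub>M lborel)" using assms by (simp add: lborel_prod)
  from lborel_pair.nn_integral_snd[OF this] show ?thesis by (simp only: lborel_prod)
qed

text \<open>It states that Lebesgue measure on the cone is \<open>C t^2 dt dA(y)\<close>. For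
  \<open>A\<close> in a plane, \<open>C\<close> is geometrically the distance from \<open>c\<close>
  to the plane divided by \<open>\<kappa>\<close>, but it is left abstract. Measurability of the
  cone is included so that the integral on the left has its usual meaning.\<close>

definition polar_formula :: "ennreal \<Rightarrow> real^3 \<Rightarrow> (real^3) set \<Rightarrow> bool" where
  "polar_formula C c A \<longleftrightarrow> cone_over c A \<in> sets borel \<and>
    (\<forall>h\<in>borel_measurable borel. (\<integral>\<^sup>+x. h x * indicator (cone_over c A) x \<partial>lborel) =
      C * (\<integral>\<^sup>+t. ennreal (t\<^sup>2) * indicator {0<..1} t *
        (\<integral>\<^sup>+y. h (c + t *\<^sub>R (y - c)) * indicator A y \<partial>area_measure) \<partial>lborel))"

text \<open>Space is sliced by planes parallel to \<open>P\<close>: in the coordinates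
  \<open>c + L (u, s)\<close>, height 0 contains the apex and height 1 is \<open>P\<close>. At
  height \<open>s\<close> the cone is a copy of \<open>A\<close> scaled by \<open>s\<close>, so the
  slice integral acquires \<open>s^2\<close>. One constant serves all Borel subsets of
  \<open>P\<close>.\<close>

lemma polar_formula_plane:
  fixes P :: "(real^3) set" and c :: "real^3"
  assumes "affine P" "aff_dim P = 2" "c \<notin> P"
  shows "\<exists>C<\<infinity>. \<forall>A\<in>sets borel. A \<subseteq> P \<longrightarrow> polar_formula C c A"
proof -
  obtain p and \<psi> :: "real \<times> real \<Rightarrow> real^3"
    where chart: "linear \<psi>" "\<And>u. norm (\<psi> u) = norm u" "P = range (\<lambda>u. p + \<psi> u)"
    using plane_chart[OF assms(1,2)] by metis
  obtain \<kappa> where \<kappa>: "0 < \<kappa>" "\<kappa> < \<infinity>" "(area_measure :: (real \<times> real) measure) = density lborel (\<lambda>_. \<kappa>)"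
    using area_measure_plane by metis
  note lin = linear_add[OF chart(1)] linear_diff[OF chart(1)] linear_scale[OF chart(1)]
  define n where "n = p - c"
  \<comment> \<open>Since \<open>c\<close> is outside \<open>P\<close>, the vector \<open>n\<close>
    is transversal to the directions of \<open>P\<close>; this makes \<open>L\<close>
    invertible.\<close>
  have n: "n \<noteq> \<psi> v" for v
  proof
    assume "n = \<psi> v"
    then have "c = p + \<psi> (- v)" by (simp add: n_def linear_neg[OF chart(1)] algebra_simps)
    then show False using assms(3) chart(3) by blast
  qed
  define L where "L z = \<psi> (fst z) + snd z *\<^sub>R n" for z
  have L: "linear L" by (rule linearI) (simp_all add: L_def lin algebra_simps)
  have "inj L"
  proof (rule linear_injective_0[THEN iffD2, OF L], intro allI impI)
    fix z assume z: "L z = 0"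
    have "snd z = 0"
    proof (rule ccontr)
      assume "snd z \<noteq> 0"
      have "n = (1 / snd z) *\<^sub>R (snd z *\<^sub>R n)" using \<open>snd z \<noteq> 0\<close> by simp
      also have "snd z *\<^sub>R n = \<psi> (- fst z)"
        using z by (simp add: L_def linear_neg[OF chart(1)] eq_neg_iff_add_eq_0 add.commute)
      also have "(1 / snd z) *\<^sub>R \<dots> = \<psi> ((1 / snd z) *\<^sub>R (- fst z))" by (simp only: lin)
      finally show False using n by blast
    qed
    then have "\<psi> (fst z) = 0" using z by (simp add: L_def)
    then have "fst z = 0" using chart(2)[of "fst z"] by simp
    with \<open>snd z = 0\<close> show "z = 0" by (simp add: prod_eq_iff)
  qed
  have "dim (range L) = 3"
    using dim_image_eq[OF L, of UNIV] \<open>inj L\<close> by simp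
  then have "span (range L) = UNIV" using dim_eq_full[of "range L"] by simp
  then have "surj L"
    using linear_subspace_image[OF L subspace_UNIV] by (simp add: span_eq_iff[THEN iffD2])
  obtain K where K: "linear K" "\<And>z. K (L z) = z"
    using linear_injective_left_inverse[OF L \<open>inj L\<close>] by (auto simp: fun_eq_iff)
  have LK: "L (K x) = x" for x using K(2) \<open>surj L\<close> by (metis surjD)
  note linear_borel_measurable[OF chart(1), measurable] linear_borel_measurable[OF K(1), measurable]
    linear_borel_measurable[OF L, measurable]
  \<comment> \<open>\<open>k\<close> is the factor by which \<open>L\<close> scales volume,
    geometrically the height of \<open>c\<close> above \<open>P\<close>.\<close>
  obtain k where k: "k < \<infinity>" "distr lborel borel (\<lambda>x. - K c + K x) = density lborel (\<lambda>_. k)"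
    using distr_lborel_affine_eq[OF K(1) L LK K(2)] by metis
  have lborel_L: "(\<integral>\<^sup>+x. H x \<partial>lborel) = k * (\<integral>\<^sup>+s. (\<integral>\<^sup>+u. H (c + L (u, s)) \<partial>lborel) \<partial>lborel)"
    if [measurable]: "H \<in> borel_measurable borel" for H :: "real^3 \<Rightarrow> ennreal"
  proof -
    have "c + L (- K c + K x) = x" for x
      using linear_add[OF L, of "- K c" "K x"] by (simp add: linear_neg[OF L] LK)
    then have "(\<integral>\<^sup>+x. H x \<partial>lborel) = (\<integral>\<^sup>+x. H (c + L (- K c + K x)) \<partial>lborel)" by simp
    also have "\<dots> = (\<integral>\<^sup>+z. H (c + L z) \<partial>distr lborel borel (\<lambda>x. - K c + K x))"
      by (subst nn_integral_distr) auto
    also have "\<dots> = k * (\<integral>\<^sup>+z. H (c + L z) \<partial>lborel)"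
      unfolding k(2) by (simp add: nn_integral_density nn_integral_cmult)
    also have "(\<integral>\<^sup>+z. H (c + L z) \<partial>lborel) = (\<integral>\<^sup>+s. (\<integral>\<^sup>+u. H (c + L (u, s)) \<partial>lborel) \<partial>lborel)"
      by (rule nn_integral_lborel_Pair) measurable
    finally show ?thesis .
  qed
  have cone_iff: "c + L (u, s) \<in> cone_over c A \<longleftrightarrow> 0 < s \<and> s \<le> 1 \<and> p + \<psi> ((1 / s) *\<^sub>R u) \<in> A"
    if A: "A \<subseteq> P" for A u s
  proof
    assume "c + L (u, s) \<in> cone_over c A"
    then obtain t y where ty: "0 < t" "t \<le> 1" "y \<in> A" "L (u, s) = t *\<^sub>R (y - c)"
      by (auto simp: cone_over_def)
    obtain w where w: "y = p + \<psi> w" using ty(3) A chart(3) by blast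
    have "L (u, s) = L (t *\<^sub>R w, t)"
      unfolding ty(4) w by (simp add: L_def n_def lin algebra_simps)
    then have "u = t *\<^sub>R w" "s = t" using \<open>inj L\<close> by (auto dest: injD)
    then show "0 < s \<and> s \<le> 1 \<and> p + \<psi> ((1 / s) *\<^sub>R u) \<in> A" using ty w by simp
  next
    assume s: "0 < s \<and> s \<le> 1 \<and> p + \<psi> ((1 / s) *\<^sub>R u) \<in> A"
    have "L (u, s) = s *\<^sub>R (p + \<psi> ((1 / s) *\<^sub>R u) - c)"
      using s by (simp add: L_def n_def lin algebra_simps)
    then show "c + L (u, s) \<in> cone_over c A" using s by (auto simp: cone_over_def)
  qed
  have cone_borel: "cone_over c A \<in> sets borel" if [measurable]: "A \<in> sets borel" and A: "A \<subseteq> P" for A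
  proof -
    have iff: "x \<in> cone_over c A \<longleftrightarrow> 0 < snd (K (x - c)) \<and> snd (K (x - c)) \<le> 1 \<and>
        p + \<psi> ((1 / snd (K (x - c))) *\<^sub>R fst (K (x - c))) \<in> A" for x
      using cone_iff[OF A, of "fst (K (x - c))" "snd (K (x - c))"] by (simp add: LK)
    have "continuous_on UNIV K" using K(1) by (simp add: linear_continuous_on linear_conv_bounded_linear)
    then have "continuous_on UNIV (\<lambda>x. K (x - c))"
      by (rule continuous_on_compose2) (auto intro: continuous_on_diff)
    then have [measurable]: "(\<lambda>x. snd (K (x - c))) \<in> borel_measurable borel" "(\<lambda>x. fst (K (x - c))) \<in> borel_measurable borel"
      by (auto intro: borel_measurable_continuous_onI continuous_on_fst continuous_on_snd)
    have "cone_over c A = {x. 0 < snd (K (x - c)) \<and> snd (K (x - c)) \<le> 1 \<and>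
        p + \<psi> ((1 / snd (K (x - c))) *\<^sub>R fst (K (x - c))) \<in> A}"
      using iff by blast
    also have "\<dots> \<in> sets borel" by measurable
    finally show ?thesis .
  qed
  have main: "(\<integral>\<^sup>+x. h x * indicator (cone_over c A) x \<partial>lborel) =
      k / \<kappa> * (\<integral>\<^sup>+t. ennreal (t\<^sup>2) * indicator {0<..1} t *
        (\<integral>\<^sup>+y. h (c + t *\<^sub>R (y - c)) * indicator A y \<partial>area_measure) \<partial>lborel)"
    if Ab [measurable]: "A \<in> sets borel" and A: "A \<subseteq> P" and [measurable]: "h \<in> borel_measurable borel" for A h
  proof -
    note cone_borel[OF Ab A, measurable]
    define I where "I t = (\<integral>\<^sup>+y. h (c + t *\<^sub>R (y - c)) * indicator A y \<partial>area_measure)" for t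
    have I: "I s = \<kappa> * (\<integral>\<^sup>+u. h (c + s *\<^sub>R ((p + \<psi> u) - c)) * indicator A (p + \<psi> u) \<partial>lborel)" for s
    proof -
      have "I s = (\<integral>\<^sup>+y. (h (c + s *\<^sub>R (y - c)) * indicator A y) * indicator P y \<partial>area_measure)"
        unfolding I_def using A by (intro nn_integral_cong) (auto simp: indicator_def)
      also have "\<dots> = \<kappa> * (\<integral>\<^sup>+u. h (c + s *\<^sub>R ((p + \<psi> u) - c)) * indicator A (p + \<psi> u) \<partial>lborel)"
        by (rule plane_chart_nn_integral[OF chart \<kappa>(3)]) measurable
      finally show ?thesis .
    qed
    have [measurable]: "I \<in> borel_measurable borel"
      unfolding I[abs_def] by measurable
    \<comment> \<open>Dilation by \<open>s\<close> turns the slice at height \<open>s\<close> into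
      \<open>A\<close> itself, and \<open>1 / \<kappa>\<close> converts the Lebesgue integral over
      the chart into an area integral.\<close>
    have slice: "(\<integral>\<^sup>+u. h (c + L (u, s)) * indicator (cone_over c A) (c + L (u, s)) \<partial>lborel)
        = (1 / \<kappa>) * (ennreal (s\<^sup>2) * indicator {0<..1} s * I s)" for s
    proof (cases "0 < s \<and> s \<le> 1")
      case False
      then have "indicator (cone_over c A) (c + L (u, s)) = (0::ennreal)" for u
        using cone_iff[OF A, of u s] by (auto simp: indicator_def)
      then show ?thesis using False by simp
    next
      case True
      have "(\<integral>\<^sup>+u. h (c + L (u, s)) * indicator (cone_over c A) (c + L (u, s)) \<partial>lborel)
        = ennreal (s\<^sup>2) * (\<integral>\<^sup>+u. h (c + L (s *\<^sub>R u, s)) * indicator (cone_over c A) (c + L (s *\<^sub>R u, s)) \<partial>lborel)"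
        using True by (intro nn_integral_lborel_scale_plane) auto
      also have "(\<lambda>u. h (c + L (s *\<^sub>R u, s)) * indicator (cone_over c A) (c + L (s *\<^sub>R u, s)))
          = (\<lambda>u. h (c + s *\<^sub>R ((p + \<psi> u) - c)) * indicator A (p + \<psi> u))"
      proof
        fix u
        have "L (s *\<^sub>R u, s) = s *\<^sub>R ((p + \<psi> u) - c)"
          by (simp add: L_def n_def lin algebra_simps)
        moreover have "indicator (cone_over c A) (c + L (s *\<^sub>R u, s)) = (indicator A (p + \<psi> u) :: ennreal)"
          using cone_iff[OF A, of "s *\<^sub>R u" s] True by (auto simp: indicator_def)
        ultimately show "h (c + L (s *\<^sub>R u, s)) * indicator (cone_over c A) (c + L (s *\<^sub>R u, s))
          = h (c + s *\<^sub>R ((p + \<psi> u) - c)) * indicator A (p + \<psi> u)" by simp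
      qed
      also have "(\<integral>\<^sup>+u. h (c + s *\<^sub>R ((p + \<psi> u) - c)) * indicator A (p + \<psi> u) \<partial>lborel) = (1 / \<kappa>) * I s"
        using \<kappa>(1,2) by (simp add: I mult.assoc[symmetric] ennreal_divide_times
            ennreal_divide_self zero_less_iff_neq_zero less_top)
      finally show ?thesis using True by (simp add: mult_ac)
    qed
    have "(\<integral>\<^sup>+x. h x * indicator (cone_over c A) x \<partial>lborel)
        = k * (\<integral>\<^sup>+s. (1 / \<kappa>) * (ennreal (s\<^sup>2) * indicator {0<..1} s * I s) \<partial>lborel)"
      by (subst lborel_L) (auto simp: slice)
    also have "\<dots> = k * ((1 / \<kappa>) * (\<integral>\<^sup>+s. ennreal (s\<^sup>2) * indicator {0<..1} s * I s \<partial>lborel))"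
      by (subst nn_integral_cmult) auto
    finally show ?thesis unfolding I_def
      by (simp add: mult.assoc[symmetric] ennreal_times_divide)
  qed
  have "k / \<kappa> < \<infinity>" using k(1) \<kappa>(1)
    by (auto simp: divide_ennreal_def ennreal_mult_eq_top_iff simp flip: less_top)
  moreover have "polar_formula (k / \<kappa>) c A" if "A \<in> sets borel" "A \<subseteq> P" for A
    unfolding polar_formula_def using cone_borel[OF that] main[OF that] by blast
  ultimately show ?thesis by blast
qed

lemma polar_formula_cone_borel: "polar_formula C c A \<Longrightarrow> cone_over c A \<in> sets borel"
  by (simp add: polar_formula_def)

lemma polar_formula_nn_integral:
  "polar_formula C c A \<Longrightarrow> h \<in> borel_measurable borel \<Longrightarrow>
    (\<integral>\<^sup>+x. h x * indicator (cone_over c A) x \<partial>lborel) =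
      C * (\<integral>\<^sup>+t. ennreal (t\<^sup>2) * indicator {0<..1} t *
        (\<integral>\<^sup>+y. h (c + t *\<^sub>R (y - c)) * indicator A y \<partial>area_measure) \<partial>lborel)"
  by (simp add: polar_formula_def)

lemma nn_integral_power_Ioc:
  "(\<integral>\<^sup>+t. ennreal (t ^ n) * indicator {0<..1} t \<partial>lborel) = ennreal (1 / real (Suc n))" if "0 < n"
proof -
  \<comment> \<open>As \<open>n > 0\<close>, the integrand vanishes at 0, so the left endpoint may
    be added and the fundamental theorem applied to a closed interval.\<close>
  have "(\<integral>\<^sup>+t. ennreal (t ^ n) * indicator {0<..1} t \<partial>lborel) = (\<integral>\<^sup>+t. ennreal (t ^ n) * indicator {0..1} t \<partial>lborel)"
    using that by (intro nn_integral_cong) (auto simp: indicator_def)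
  also have "\<dots> = 1 ^ Suc n / real (Suc n) - 0 ^ Suc n / real (Suc n)"
  proof (rule nn_integral_FTC_Icc)
    fix x :: real
    show "DERIV (\<lambda>t. t ^ Suc n / real (Suc n)) x :> x ^ n"
      by (auto intro!: derivative_eq_intros simp del: power_Suc)
  qed auto
  finally show ?thesis by simp
qed

text \<open>The case \<open>h = 1\<close>; the integral of \<open>t^2\<close> gives the 1/3 of a
  pyramid's volume. Read backwards, it recovers \<open>C\<close> from volume and area.\<close>

lemma polar_formula_volume:
  assumes "polar_formula C c A" "A \<in> sets borel"
  shows "emeasure lborel (cone_over c A) = C * ennreal (1 / 3) * emeasure area_measure A"
proof -
  have "emeasure lborel (cone_over c A) = C * (\<integral>\<^sup>+t. ennreal (t\<^sup>2) * indicator {0<..1} t * emeasure area_measure A \<partial>lborel)"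
    using polar_formula_nn_integral[OF assms(1), of "\<lambda>_. 1"] polar_formula_cone_borel[OF assms(1)] assms(2)
    by simp
  also have "\<dots> = C * (ennreal (1 / 3) * emeasure area_measure A)"
    using nn_integral_power_Ioc[of 2] by (simp add: nn_integral_multc)
  finally show ?thesis by (simp add: mult.assoc)
qed

section \<open>Convex bodies bounded by facets\<close>

text \<open>Facets and their cones are not disjoint, but almost every point lies in at most one of
  the sets, so the indicator of the union is almost everywhere the sum of the indicators.\<close>

lemma nn_integral_finite_UN_null:
  assumes I: "finite I" and A [measurable]: "\<And>i. i \<in> I \<Longrightarrow> A i \<in> sets M"
    and null: "\<And>i j. i \<in> I \<Longrightarrow> j \<in> I \<Longrightarrow> i \<noteq> j \<Longrightarrow> emeasure M (A i \<inter> A j) = 0"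
    and h [measurable]: "h \<in> borel_measurable M"
  shows "(\<integral>\<^sup>+x. h x * indicator (\<Union>i\<in>I. A i) x \<partial>M) = (\<Sum>i\<in>I. \<integral>\<^sup>+x. h x * indicator (A i) x \<partial>M)"
proof -
  have "AE x in M. i \<noteq> j \<longrightarrow> x \<notin> A i \<inter> A j" if "i \<in> I" "j \<in> I" for i j
  proof (cases "i = j")
    case False
    then have "A i \<inter> A j \<in> null_sets M" using null[OF that] A that by (intro null_setsI) auto
    then have "AE x in M. x \<notin> A i \<inter> A j" by (rule AE_not_in)
    then show ?thesis by eventually_elim simp
  qed simp
  then have "AE x in M. \<forall>i\<in>I. \<forall>j\<in>I. i \<noteq> j \<longrightarrow> x \<notin> A i \<inter> A j"
    using I by (simp add: AE_finite_all)
  then have "AE x in M. h x * indicator (\<Union>i\<in>I. A i) x = (\<Sum>i\<in>I. h x * indicator (A i) x)"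
  proof eventually_elim
    case (elim x)
    show ?case
    proof (cases "x \<in> (\<Union>i\<in>I. A i)")
      case True
      then obtain i where i: "i \<in> I" "x \<in> A i" by blast
      have "(\<Sum>j\<in>I. h x * indicator (A j) x) = (\<Sum>j\<in>I. if j = i then h x else 0)"
        using elim i by (intro sum.cong) (auto simp: indicator_def)
      also have "\<dots> = h x" using I i by simp
      finally show ?thesis using True by simp
    next
      case False
      then have "(\<Sum>j\<in>I. h x * indicator (A j) x) = 0"
        by (intro sum.neutral) auto
      then show ?thesis using False by simp
    qed
  qed
  then have "(\<integral>\<^sup>+x. h x * indicator (\<Union>i\<in>I. A i) x \<partial>M) = (\<integral>\<^sup>+x. (\<Sum>i\<in>I. h x * indicator (A i) x) \<partial>M)"
    by (rule nn_integral_cong_AE)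
  also have "\<dots> = (\<Sum>i\<in>I. \<integral>\<^sup>+x. h x * indicator (A i) x \<partial>M)"
    by (rule nn_integral_sum) simp
  finally show ?thesis .
qed

lemma cone_over_isometry_image:
  fixes g :: "'a::euclidean_space \<Rightarrow> 'a"
  assumes "\<And>x y. dist (g x) (g y) = dist x y"
  shows "g ` cone_over c A = cone_over (g c) (g ` A)"
proof -
  have "cone_over c A = (\<lambda>(t, y). c + t *\<^sub>R (y - c)) ` ({0<..1} \<times> A)" for c and A :: "'a set"
    by (force simp: cone_over_def)
  then show ?thesis
    by (force simp: image_image isometry_affine_combination[OF assms] split_def)
qed

section \<open>Facets of a full-dimensional polytope and the cones over them\<close>

locale polytope_body =
  fixes X :: "(real^3) set"
  assumes polytope: "polytope X" and interior_nonempty: "interior X \<noteq> {}"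
begin

abbreviation facets :: "(real^3) set set" where
  "facets \<equiv> {F. F facet_of X}"

lemma convex: "convex X" and compact: "compact X" and closed: "closed X" and bounded: "bounded X"
  using polytope by (simp_all add: polytope_imp_convex polytope_imp_compact polytope_imp_closed polytope_imp_bounded)

lemma finite_facets: "finite facets"
  using polytope by (rule finite_polytope_facets)

lemma Union_facets: "\<Union>facets = frontier X"
proof -
  have "affine hull X = UNIV" by (rule affine_hull_nonempty_interior[OF interior_nonempty])
  then show ?thesis
    using rel_frontier_of_polyhedron[OF polytope_imp_polyhedron[OF polytope]]
    by (simp add: rel_frontier_frontier)
qed

lemma frontier_eq: "frontier X = X - interior X"
  using closed by (simp add: frontier_def)

lemma facetD:
  assumes "F \<in> facets"
  shows "F face_of X" "polytope F" "convex F" "compact F" "aff_dim F = 2" "F \<subseteq> frontier X" "F \<in> sets borel"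
proof -
  show face: "F face_of X" using assms by (simp add: facet_of_def)
  then show "polytope F" using face_of_polytope_polytope polytope by blast
  then show "convex F" "compact F" "F \<in> sets borel"
    by (simp_all add: polytope_imp_convex polytope_imp_compact polytope_imp_closed)
  show "aff_dim F = 2"
    using assms aff_dim_nonempty_interior[OF interior_nonempty] by (simp add: facet_of_def)
  show "F \<subseteq> frontier X" using assms Union_facets by blast
qed

lemma facets_nonempty: "facets \<noteq> {}"
  using polytope_facet_exists[OF polytope] aff_dim_nonempty_interior[OF interior_nonempty] by auto

lemma facet_area: "F \<in> facets \<Longrightarrow> 0 < emeasure area_measure F" "F \<in> facets \<Longrightarrow> emeasure area_measure F < \<infinity>"
  using facetD area_measure_convex_body by blast+

text \<open>The intersection is a face of \<open>F\<close>, and a proper one because distinct facets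
  of equal dimension cannot be nested; so its dimension is below 2.\<close>

lemma facet_Int_area:
  assumes F: "F \<in> facets" "G \<in> facets" "F \<noteq> G"
  shows "emeasure area_measure (F \<inter> G) = 0"
proof (rule area_measure_convex_lowdim[of "affine hull F"])
  have "F \<inter> G face_of F"
    using face_of_Int[OF facetD(1)[OF F(1)] facetD(1)[OF F(2)]] Int_lower1
      face_of_imp_subset[OF facetD(1)[OF F(1)]]
    by (rule face_of_subset)
  moreover have "F \<inter> G \<noteq> F"
  proof
    assume "F \<inter> G = F"
    then have "F \<subseteq> G" by blast
    then have "F face_of G"
      using face_of_subset[OF facetD(1)[OF F(1)]] face_of_imp_subset[OF facetD(1)[OF F(2)]] by blast
    then have "aff_dim F < aff_dim G"
      using face_of_aff_dim_lt facetD(3) F by blast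
    then show False using facetD(5) F by simp
  qed
  ultimately show "aff_dim (F \<inter> G) < 2"
    using face_of_aff_dim_lt[of F "F \<inter> G"] facetD(3,5)[OF F(1)] by simp
  show "F \<inter> G \<subseteq> affine hull F" using hull_subset[of F affine] by blast
qed (use facetD F in \<open>auto intro: convex_Int\<close>)

text \<open>A facet, and with it its affine hull, lies in the bounding plane of a half-space
  containing \<open>X\<close>, whereas an interior point of \<open>X\<close> is strictly inside.
  This makes polar coordinates around \<open>c\<close> available for every facet.\<close>

lemma interior_notin_facet_hull:
  assumes "c \<in> interior X" "F \<in> facets"
  shows "c \<notin> affine hull F"
proof
  assume c: "c \<in> affine hull F"
  obtain a b where ab: "a \<noteq> 0" "X \<subseteq> {x. a \<bullet> x \<le> b}" "F = X \<inter> {x. a \<bullet> x = b}"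
    using facet_of_polyhedron[OF polytope_imp_polyhedron[OF polytope]] assms(2) by blast
  have "affine hull F \<subseteq> {x. a \<bullet> x = b}"
    by (rule hull_minimal) (use ab affine_hyperplane in auto)
  moreover have "c \<in> interior {x. a \<bullet> x \<le> b}" using assms(1) interior_mono[OF ab(2)] by blast
  ultimately show False using c interior_halfspace_le[OF ab(1)] by auto
qed

lemma nn_integral_frontier:
  assumes "h \<in> borel_measurable borel"
  shows "(\<integral>\<^sup>+y. h y * indicator (frontier X) y \<partial>area_measure)
    = (\<Sum>F\<in>facets. \<integral>\<^sup>+y. h y * indicator F y \<partial>area_measure)"
  using nn_integral_finite_UN_null[OF finite_facets, of "\<lambda>F. F" area_measure h]
    facet_Int_area facetD(7) assms by (simp add: Union_facets cong: measurable_cong_sets)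

lemma segment_to_body_interior:
  assumes "c \<in> interior X" "y \<in> X" "0 < t" "t < 1"
  shows "c + t *\<^sub>R (y - c) \<in> interior X"
proof (cases "y = c")
  case False
  then have "c + t *\<^sub>R (y - c) \<in> open_segment c y"
    using assms by (auto simp: in_segment algebra_simps intro!: exI[of _ t])
  then show ?thesis
    using in_interior_closure_convex_segment[OF convex assms(1)] assms(2) closed by auto
qed (use assms in simp)

text \<open>The ray from \<open>c\<close> through any other point of \<open>X\<close> leaves
  \<open>X\<close> at a frontier point, which lies on some facet.\<close>

lemma Union_cones:
  assumes c: "c \<in> interior X"
  shows "(\<Union>F\<in>facets. cone_over c F) = X - {c}"
proof (intro equalityI subsetI)
  fix x assume "x \<in> (\<Union>F\<in>facets. cone_over c F)"
  then obtain F t y where *: "F \<in> facets" "y \<in> F" "0 < t" "t \<le> 1" "x = c + t *\<^sub>R (y - c)"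
    by (auto simp: cone_over_def)
  have y: "y \<in> X" "y \<notin> interior X" using * facetD(6)[OF *(1)] frontier_eq by auto
  have "x \<in> X"
    using y(1) segment_to_body_interior[OF c y(1) *(3)] *(4,5) interior_subset by (cases "t = 1") auto
  moreover have "x \<noteq> c" using y(2) c * by auto
  ultimately show "x \<in> X - {c}" by simp
next
  fix x assume x: "x \<in> X - {c}"
  then obtain d where d: "0 < d" "c + d *\<^sub>R (x - c) \<in> frontier X"
    using ray_to_frontier[OF bounded c, of "x - c"] by auto
  \<comment> \<open>For \<open>d < 1\<close> the exit point would lie strictly between
    \<open>c\<close> and \<open>x\<close> and hence be interior. So \<open>1 / d\<close> is an
    admissible cone parameter.\<close>
  have "\<not> d < 1"
    using segment_to_body_interior[OF c, of x d] x d frontier_eq by auto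
  moreover obtain F where F: "F \<in> facets" "c + d *\<^sub>R (x - c) \<in> F" using d(2) Union_facets by blast
  moreover have "x = c + (1 / d) *\<^sub>R ((c + d *\<^sub>R (x - c)) - c)" using d(1) by simp
  ultimately have "x \<in> cone_over c F"
    unfolding cone_over_def by (intro CollectI exI[of _ "1 / d"] exI[of _ "c + d *\<^sub>R (x - c)"]) auto
  then show "x \<in> (\<Union>F\<in>facets. cone_over c F)" using F(1) by blast
qed

text \<open>A ray from an interior point meets the frontier only once, since the nearer of two
  frontier points on it would be interior. Hence the base points in \<open>F\<close> and in
  \<open>G\<close> coincide.\<close>

lemma cone_over_Int:
  assumes c: "c \<in> interior X" and FG: "F \<in> facets" "G \<in> facets"
  shows "cone_over c F \<inter> cone_over c G \<subseteq> cone_over c (F \<inter> G)"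
proof
  fix x assume x: "x \<in> cone_over c F \<inter> cone_over c G"
  then obtain t y where ty: "0 < t" "t \<le> 1" "y \<in> F" "x = c + t *\<^sub>R (y - c)"
    by (auto simp: cone_over_def)
  from x obtain s z where sz: "0 < s" "s \<le> 1" "z \<in> G" "x = c + s *\<^sub>R (z - c)"
    by (auto simp: cone_over_def)
  have y: "y \<in> X" "y \<notin> interior X" using ty facetD(6)[OF FG(1)] frontier_eq by auto
  have z: "z \<in> X" "z \<notin> interior X" using sz facetD(6)[OF FG(2)] frontier_eq by auto
  have eq: "t *\<^sub>R (y - c) = s *\<^sub>R (z - c)" using ty(4) sz(4) by simp
  have "z - c = (1 / s) *\<^sub>R (t *\<^sub>R (y - c))" unfolding eq using sz(1) by simp
  then have z_eq: "z = c + (t / s) *\<^sub>R (y - c)" by (simp add: algebra_simps)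
  have "y - c = (1 / t) *\<^sub>R (s *\<^sub>R (z - c))" unfolding eq[symmetric] using ty(1) by simp
  then have y_eq: "y = c + (s / t) *\<^sub>R (z - c)" by (simp add: algebra_simps)
  have "\<not> t < s" using segment_to_body_interior[OF c y(1), of "t / s"] z(2) z_eq ty(1) sz(1) by auto
  moreover have "\<not> s < t" using segment_to_body_interior[OF c z(1), of "s / t"] y(2) y_eq ty(1) sz(1) by auto
  ultimately have "y = z" using z_eq ty(1) by simp
  with ty sz show "x \<in> cone_over c (F \<inter> G)" by (auto simp: cone_over_def)
qed

lemma facet_polar_formula:
  assumes c: "c \<in> interior X" and F: "F \<in> facets"
  obtains C where "C < \<infinity>" "\<And>A. A \<in> sets borel \<Longrightarrow> A \<subseteq> F \<Longrightarrow> polar_formula C c A"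
proof -
  have "affine (affine hull F)" "aff_dim (affine hull F) = 2" "c \<notin> affine hull F"
    using facetD(5)[OF F] interior_notin_facet_hull[OF c F] by auto
  from polar_formula_plane[OF this]
  obtain C where C: "C < \<infinity>" "\<forall>A\<in>sets borel. A \<subseteq> affine hull F \<longrightarrow> polar_formula C c A" by blast
  have "polar_formula C c A" if "A \<in> sets borel" "A \<subseteq> F" for A
    using C(2) that hull_subset[of F affine] by blast
  then show ?thesis using C(1) that by blast
qed

text \<open>Two cones overlap only inside the cone over an intersection of facets; that intersection
  has zero area, and the polar formula turns zero area of the base into zero volume of the cone. The
  apex, missing from all cones, is a null set.\<close>

lemma nn_integral_body:
  assumes c: "c \<in> interior X" and h: "h \<in> borel_measurable borel"
  shows "(\<integral>\<^sup>+x. h x * indicator X x \<partial>lborel)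
    = (\<Sum>F\<in>facets. \<integral>\<^sup>+x. h x * indicator (cone_over c F) x \<partial>lborel)"
proof -
  have cone: "cone_over c A \<in> sets borel"
    "emeasure area_measure A = 0 \<Longrightarrow> emeasure lborel (cone_over c A) = 0"
    if "F \<in> facets" "A \<in> sets borel" "A \<subseteq> F" for F A
    using facet_polar_formula[OF c that(1)] that(2,3) polar_formula_cone_borel polar_formula_volume
    by (metis mult_zero_right)+
  have "AE x in lborel. x \<noteq> c" by (rule AE_lborel_singleton)
  then have "(\<integral>\<^sup>+x. h x * indicator X x \<partial>lborel) = (\<integral>\<^sup>+x. h x * indicator (X - {c}) x \<partial>lborel)"
    by (intro nn_integral_cong_AE) (auto elim!: eventually_mono simp: indicator_def)
  also have "\<dots> = (\<integral>\<^sup>+x. h x * indicator (\<Union>F\<in>facets. cone_over c F) x \<partial>lborel)"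
    by (simp only: Union_cones[OF c])
  also have "\<dots> = (\<Sum>F\<in>facets. \<integral>\<^sup>+x. h x * indicator (cone_over c F) x \<partial>lborel)"
  proof (rule nn_integral_finite_UN_null[OF finite_facets])
    show "cone_over c F \<in> sets lborel" if "F \<in> facets" for F
      using cone(1)[OF that facetD(7)[OF that]] by simp
    fix F G assume FG: "F \<in> facets" "G \<in> facets" "F \<noteq> G"
    have "F \<inter> G \<in> sets borel" using facetD(7) FG by blast
    from cone[OF FG(1) this] have "emeasure lborel (cone_over c (F \<inter> G)) = 0"
      "cone_over c (F \<inter> G) \<in> sets lborel"
      using facet_Int_area[OF FG] by auto
    moreover have "emeasure lborel (cone_over c F \<inter> cone_over c G) \<le> emeasure lborel (cone_over c (F \<inter> G))"
      using cone_over_Int[OF c FG(1,2)] calculation(2) by (rule emeasure_mono)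
    ultimately show "emeasure lborel (cone_over c F \<inter> cone_over c G) = 0" by simp
  qed (use h in simp)
  finally show ?thesis .
qed

text \<open>Transitivity on flags says something about a facet only if the facet belongs to a flag;
  a facet of the facet, and a facet of that, supply the edge and the vertex.\<close>

lemma facet_in_flag:
  assumes "F \<in> facets"
  shows "\<exists>V E. is_flag X V E F"
proof -
  note F = facetD[OF assms]
  obtain E where E: "E facet_of F"
    using polytope_facet_exists[OF F(2)] F(5) by auto
  have "polytope E" "aff_dim E = 1"
    using E face_of_polytope_polytope[OF F(2)] F(5) by (auto simp: facet_of_def)
  then obtain V where V: "V facet_of E"
    using polytope_facet_exists[of E] by auto
  have "E face_of X" using E F(1) face_of_trans by (auto simp: facet_of_def)
  moreover have "V face_of X" using V \<open>E face_of X\<close> face_of_trans by (auto simp: facet_of_def)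
  moreover have "aff_dim V = 0" using V \<open>aff_dim E = 1\<close> by (simp add: facet_of_def)
  ultimately have "is_flag X V E F"
    using F(1,5) \<open>aff_dim E = 1\<close> facet_of_imp_subset[OF E] facet_of_imp_subset[OF V]
    by (simp add: is_flag_def)
  then show ?thesis by blast
qed

section \<open>The surface measure and its centroid\<close>

text \<open>Building the frontier into the measure gives a finite measure, so that constants are
  integrable and integrals carry no indicator.\<close>

definition surface :: "(real^3) measure" where
  "surface = density area_measure (indicator (frontier X))"

lemma frontier_borel [measurable]: "frontier X \<in> sets borel"
  by (simp add: borel_closed)

lemma sets_surface [simp, measurable_cong]: "sets surface = sets borel"
  by (simp add: surface_def)

lemma space_surface [simp]: "space surface = UNIV"
  by (simp add: surface_def)

lemma nn_integral_surface:
  "h \<in> borel_measurable borel \<Longrightarrow>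
    (\<integral>\<^sup>+y. h y \<partial>surface) = (\<integral>\<^sup>+y. h y * indicator (frontier X) y \<partial>area_measure)"
  unfolding surface_def by (subst nn_integral_density) (auto simp: mult.commute)

lemma emeasure_surface: "emeasure surface UNIV = emeasure area_measure (frontier X)"
  using nn_integral_surface[of "\<lambda>_. 1"] by simp

lemma nn_integral_surface_facets:
  "h \<in> borel_measurable borel \<Longrightarrow>
    (\<integral>\<^sup>+y. h y \<partial>surface) = (\<Sum>F\<in>facets. \<integral>\<^sup>+y. h y * indicator F y \<partial>area_measure)"
  by (simp add: nn_integral_surface nn_integral_frontier)

lemma emeasure_surface_facets: "emeasure surface UNIV = (\<Sum>F\<in>facets. emeasure area_measure F)"
  using nn_integral_surface_facets[of "\<lambda>_. 1"] facetD(7) by simp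

lemma finite_measure_surface: "finite_measure surface"
  by (rule finite_measureI)
    (use facet_area(2) finite_facets in \<open>auto simp: emeasure_surface_facets less_top\<close>)

lemma measure_surface_pos: "0 < measure surface UNIV"
proof -
  obtain F where "F \<in> facets" using facets_nonempty by blast
  then have "0 < emeasure area_measure F" "emeasure area_measure F \<le> emeasure surface UNIV"
    using facet_area(1) finite_facets unfolding emeasure_surface_facets
    by (auto intro!: member_le_sum)
  then have "0 < emeasure surface UNIV" by (rule less_le_trans)
  then show ?thesis
    using finite_measure.emeasure_eq_measure[OF finite_measure_surface] by simp
qed

lemma measure_surface: "measure surface UNIV = measure area_measure (frontier X)"
  by (simp add: measure_def emeasure_surface)

lemma AE_surface: "AE y in surface. y \<in> frontier X"
  unfolding surface_def by (subst AE_density) (auto simp: indicator_def)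

lemma integral_surface:
  fixes f :: "real^3 \<Rightarrow> 'b::{banach, second_countable_topology}"
  assumes "f \<in> borel_measurable borel"
  shows "integral\<^sup>L surface f = (LINT y:frontier X|area_measure. f y)"
    and "integrable surface f \<longleftrightarrow> set_integrable area_measure (frontier X) f"
proof -
  have "surface = density area_measure (\<lambda>x. ennreal (indicator (frontier X) x))"
    by (simp add: surface_def ennreal_indicator)
  then show "integral\<^sup>L surface f = (LINT y:frontier X|area_measure. f y)"
    "integrable surface f \<longleftrightarrow> set_integrable area_measure (frontier X) f"
    using assms by (simp_all add: integral_density integrable_density set_lebesgue_integral_def
        set_integrable_def cong: measurable_cong_sets)
qed

lemma integrable_surface_bounded:
  fixes f :: "real^3 \<Rightarrow> 'b::{banach, second_countable_topology}"
  assumes "f \<in> borel_measurable borel" "\<And>x. x \<in> X \<Longrightarrow> norm (f x) \<le> B"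
  shows "integrable surface f"
proof (rule finite_measure.integrable_const_bound[OF finite_measure_surface])
  show "AE x in surface. norm (f x) \<le> B"
    using AE_surface by eventually_elim (use assms(2) frontier_eq in auto)
qed (use assms(1) in \<open>simp cong: measurable_cong_sets\<close>)

lemma integrable_surface_id: "integrable surface (\<lambda>y. y)"
proof -
  obtain B where "\<And>x. x \<in> X \<Longrightarrow> norm x \<le> B" using bounded by (auto simp: bounded_iff)
  then show ?thesis by (intro integrable_surface_bounded) auto
qed

definition surface_centroid :: "real^3" where
  "surface_centroid = (1 / measure surface UNIV) *\<^sub>R (\<integral>y. y \<partial>surface)"

lemma integral_surface_id: "(\<integral>y. y \<partial>surface) = measure surface UNIV *\<^sub>R surface_centroid"
  using measure_surface_pos by (simp add: surface_centroid_def)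

text \<open>The linear part has mean zero by the choice of the centroid.\<close>

lemma integral_surface_affine:
  "(\<integral>y. b + w \<bullet> (y - surface_centroid) \<partial>surface) = b * measure surface UNIV"
proof -
  interpret finite_measure surface by (rule finite_measure_surface)
  have "(\<integral>y. b + w \<bullet> (y - surface_centroid) \<partial>surface)
      = (\<integral>y. b - w \<bullet> surface_centroid + w \<bullet> y \<partial>surface)"
    by (simp add: inner_diff_right algebra_simps)
  also have "\<dots> = (b - w \<bullet> surface_centroid) * measure surface UNIV + w \<bullet> (\<integral>y. y \<partial>surface)"
    using integrable_surface_id by (subst Bochner_Integration.integral_add) auto
  also have "\<dots> = b * measure surface UNIV"
    by (simp add: integral_surface_id algebra_simps)
  finally show ?thesis .
qed

lemma integrable_surface_affine:
  "integrable surface (\<lambda>y. b + w \<bullet> (y - surface_centroid))"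
proof -
  interpret finite_measure surface by (rule finite_measure_surface)
  show ?thesis using integrable_surface_id by (simp add: inner_diff_right)
qed

text \<open>A linear function vanishing at the centroid integrates to 0 over the surface. A centroid
  outside \<open>X\<close> could be strictly separated from \<open>X\<close>, producing such a
  function bounded below on the surface by a positive constant.\<close>

lemma surface_centroid_in_body: "surface_centroid \<in> X"
proof (rule ccontr)
  assume "surface_centroid \<notin> X"
  then obtain a b where ab: "a \<bullet> surface_centroid < b" "\<And>x. x \<in> X \<Longrightarrow> b < a \<bullet> x"
    using separating_hyperplane_closed_point[OF convex closed] by metis
  interpret finite_measure surface by (rule finite_measure_surface)
  have "(\<integral>y. b - a \<bullet> surface_centroid \<partial>surface) \<le> (\<integral>y. 0 + a \<bullet> (y - surface_centroid) \<partial>surface)"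
  proof (rule integral_mono_AE)
    show "AE y in surface. b - a \<bullet> surface_centroid \<le> 0 + a \<bullet> (y - surface_centroid)"
      using AE_surface
    proof eventually_elim
      case (elim y)
      then have "b < a \<bullet> y" using ab(2) frontier_eq by auto
      then show ?case by (simp add: inner_diff_right)
    qed
  qed (use integrable_surface_affine[of 0 a] in auto)
  also have "\<dots> = 0" unfolding integral_surface_affine by simp
  finally have "measure surface UNIV * (b - a \<bullet> surface_centroid) \<le> 0" by simp
  then show False using measure_surface_pos ab(1) by (simp add: mult_le_0_iff)
qed

text \<open>The affine minorant of \<open>f\<close> at the centroid, which exists at an interior
  point, is integrated over the surface; its linear part contributes nothing.\<close>

lemma surface_jensen:
  assumes f: "convex_on X f" "f \<in> borel_measurable borel" "integrable surface f"
    and c: "surface_centroid \<in> interior X"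
  shows "f surface_centroid * measure surface UNIV \<le> (\<integral>y. f y \<partial>surface)"
proof -
  obtain w where w: "\<And>x. x \<in> X \<Longrightarrow> f surface_centroid + w \<bullet> (x - surface_centroid) \<le> f x"
    using convex_on_subgradient[OF f(1) c] by metis
  have "(\<integral>y. f surface_centroid + w \<bullet> (y - surface_centroid) \<partial>surface) \<le> (\<integral>y. f y \<partial>surface)"
  proof (rule integral_mono_AE[OF integrable_surface_affine f(3)])
    show "AE y in surface. f surface_centroid + w \<bullet> (y - surface_centroid) \<le> f y"
      using AE_surface by eventually_elim (use w frontier_eq in auto)
  qed
  then show ?thesis unfolding integral_surface_affine .
qed

section \<open>Action of a symmetry on the body and its surface\<close>

context
  fixes g :: "real^3 \<Rightarrow> real^3"
  assumes sym: "is_symmetry X g"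
begin

lemma symmetry_dist: "dist (g x) (g y) = dist x y"
  using sym by (simp add: is_symmetry_def)

lemma symmetry_inj: "inj g"
  by (metis symmetry_dist dist_eq_0_iff injI)

lemma symmetry_mem_iff: "g x \<in> X \<longleftrightarrow> x \<in> X"
proof -
  have "g ` X = X" using sym by (simp add: is_symmetry_def)
  then show ?thesis using inj_image_mem_iff[OF symmetry_inj] by metis
qed

lemma symmetry_interior_iff: "g x \<in> interior X \<longleftrightarrow> x \<in> interior X"
proof -
  have "ball (g x) e = g ` ball x e" for e
  proof
    show "ball (g x) e \<subseteq> g ` ball x e"
    proof
      fix z assume z: "z \<in> ball (g x) e"
      obtain y where "z = g y" using isometry_surj[OF symmetry_dist] by (metis surjD)
      with z show "z \<in> g ` ball x e" by (simp add: symmetry_dist)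
    qed
  qed (auto simp: symmetry_dist)
  then have "ball (g x) e \<subseteq> X \<longleftrightarrow> ball x e \<subseteq> X" for e
    using symmetry_mem_iff by auto
  then show ?thesis by (simp add: mem_interior)
qed

lemma symmetry_frontier_iff: "g x \<in> frontier X \<longleftrightarrow> x \<in> frontier X"
  by (simp add: frontier_eq symmetry_mem_iff symmetry_interior_iff)

lemma symmetry_borel_measurable: "g \<in> borel_measurable borel"
  by (rule borel_measurable_continuous_onI) (rule continuous_on_isometry[OF symmetry_dist])

text \<open>Area and frontier are invariant under \<open>g\<close>, so \<open>y\<close> and
  \<open>g y\<close> have the same mean over the surface; and \<open>g\<close>, being affine,
  commutes with taking means.\<close>

lemma symmetry_surface_centroid: "g surface_centroid = surface_centroid"
proof -
  note [measurable] = symmetry_borel_measurable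
  interpret finite_measure surface by (rule finite_measure_surface)
  obtain T where T: "orthogonal_transformation T" "\<And>x. g x = g 0 + T x"
    using isometry_eq_orthogonal[OF symmetry_dist] by metis
  have L: "bounded_linear T"
    using orthogonal_transformation_linear[OF T(1)] by (simp add: linear_conv_bounded_linear)
  have distr: "distr area_measure borel g = area_measure"
    using distr_area_measure_isometry[OF symmetry_dist] isometry_surj[OF symmetry_dist]
    by (simp add: density_one)
  have "(\<integral>y. y \<partial>surface) = (\<integral>y. indicator (frontier X) y *\<^sub>R y \<partial>area_measure)"
    by (simp add: integral_surface set_lebesgue_integral_def)
  also have "\<dots> = (\<integral>y. indicator (frontier X) y *\<^sub>R y \<partial>distr area_measure borel g)"
    by (simp only: distr)
  also have "\<dots> = (\<integral>y. indicator (frontier X) (g y) *\<^sub>R g y \<partial>area_measure)"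
    by (rule integral_distr) measurable
  also have "\<dots> = (\<integral>y. indicator (frontier X) y *\<^sub>R g y \<partial>area_measure)"
    by (simp add: indicator_def symmetry_frontier_iff)
  also have "\<dots> = (\<integral>y. g y \<partial>surface)"
    by (simp add: integral_surface set_lebesgue_integral_def)
  also have "\<dots> = (\<integral>y. g 0 + T y \<partial>surface)" by (simp only: T(2)[symmetric])
  also have "\<dots> = measure surface UNIV *\<^sub>R g 0 + T (\<integral>y. y \<partial>surface)"
    using integral_bounded_linear[OF L integrable_surface_id]
      integrable_bounded_linear[OF L integrable_surface_id]
    by (subst Bochner_Integration.integral_add) auto
  also have "\<dots> = measure surface UNIV *\<^sub>R g surface_centroid"
    by (simp add: integral_surface_id T(2)[of surface_centroid] linear_simps(5)[OF L] scaleR_add_right)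
  finally show ?thesis
    using measure_surface_pos by (simp add: integral_surface_id)
qed

end

end

section \<open>The inequality for bodies with transitive symmetry on facets\<close>

lemma nn_integral_square_mult_Ioc:
  "(\<integral>\<^sup>+t. ennreal (t\<^sup>2 * (1 - t)) * indicator {0<..1} t \<partial>lborel) = ennreal (1 / 12)"
proof -
  have "(\<integral>\<^sup>+t. ennreal (t\<^sup>2 * (1 - t)) * indicator {0<..1} t \<partial>lborel)
      = (\<integral>\<^sup>+t. ennreal (t\<^sup>2 * (1 - t)) * indicator {0..1} t \<partial>lborel)"
    by (intro nn_integral_cong) (auto simp: indicator_def)
  also have "\<dots> = (1 ^ 3 / 3 - 1 ^ 4 / 4) - (0 ^ 3 / 3 - 0 ^ 4 / 4 :: real)"
  proof (rule nn_integral_FTC_Icc)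
    fix x :: real
    show "DERIV (\<lambda>t. t ^ 3 / 3 - t ^ 4 / 4) x :> x\<^sup>2 * (1 - x)"
      by (auto intro!: derivative_eq_intros simp: algebra_simps eval_nat_numeral)
  qed auto
  finally show ?thesis by simp
qed

locale facet_transitive_body = polytope_body +
  assumes facet_transitive:
    "F \<in> facets \<Longrightarrow> G \<in> facets \<Longrightarrow> \<exists>g. is_symmetry X g \<and> g ` F = G"
begin

text \<open>If the centroid lay on one facet, it would by symmetry lie on all of them; but the ray from it
  through an interior point \<open>x\<close> leaves \<open>X\<close> in a facet that would then contain \<open>x\<close>.\<close>

lemma surface_centroid_interior: "surface_centroid \<in> interior X"
proof (rule ccontr)
  let ?s = surface_centroid
  assume "?s \<notin> interior X"
  then have "?s \<in> frontier X" using surface_centroid_in_body frontier_eq by blast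
  then obtain F where F: "F \<in> facets" "?s \<in> F" using Union_facets by blast
  have all: "?s \<in> G" if "G \<in> facets" for G
    using facet_transitive[OF F(1) that] symmetry_surface_centroid F(2) by (metis image_eqI)
  obtain x where x: "x \<in> interior X" using interior_nonempty by blast
  then have "x - ?s \<noteq> 0" using \<open>?s \<notin> interior X\<close> by auto
  from ray_to_frontier[OF bounded x this]
  obtain d where d: "0 < d" "x + d *\<^sub>R (x - ?s) \<in> frontier X" by metis
  then obtain G where G: "G \<in> facets" "x + d *\<^sub>R (x - ?s) \<in> G" using Union_facets by blast
  \<comment> \<open>These weights come from solving \<open>y = x + d (x - s)\<close> for
    \<open>x\<close>, where \<open>y\<close> is the exit point and \<open>s\<close> the
    centroid.\<close>
  have "(d / (1 + d)) *\<^sub>R ?s + (1 / (1 + d)) *\<^sub>R (x + d *\<^sub>R (x - ?s)) \<in> G"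
    using facetD(3)[OF G(1)] all[OF G(1)] G(2) d(1)
    by (intro convexD) (auto simp: field_simps)
  also have "(d / (1 + d)) *\<^sub>R ?s + (1 / (1 + d)) *\<^sub>R (x + d *\<^sub>R (x - ?s)) = (1 / (1 + d)) *\<^sub>R ((1 + d) *\<^sub>R x)"
    by (simp add: algebra_simps)
  also have "\<dots> = x" using d(1) by simp
  finally have "x \<in> frontier X" using facetD(6)[OF G(1)] by blast
  with x show False by (simp add: frontier_eq)
qed

text \<open>Each constant satisfies: volume of the cone equals \<open>C / 3\<close> times area of
  the facet. A symmetry fixes the centroid and carries cone to cone, preserving both quantities; as
  the area is positive and finite, the constants agree.\<close>

lemma common_polar_formula: "\<exists>C<\<infinity>. \<forall>F\<in>facets. polar_formula C surface_centroid F"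
proof -
  let ?s = surface_centroid
  obtain F\<^sub>0 where F\<^sub>0: "F\<^sub>0 \<in> facets" using facets_nonempty by blast
  obtain C where C: "C < \<infinity>" "polar_formula C ?s F\<^sub>0"
    using facet_polar_formula[OF surface_centroid_interior F\<^sub>0] facetD(7)[OF F\<^sub>0] by (metis order_refl)
  have "polar_formula C ?s F" if F: "F \<in> facets" for F
  proof -
    obtain D where D: "D < \<infinity>" "polar_formula D ?s F"
      using facet_polar_formula[OF surface_centroid_interior F] facetD(7)[OF F] by (metis order_refl)
    obtain g where g: "is_symmetry X g" "g ` F\<^sub>0 = F" using facet_transitive[OF F\<^sub>0 F] by blast
    note iso = symmetry_dist[OF g(1)]
    have cone: "g ` cone_over ?s F\<^sub>0 = cone_over ?s F"
      using cone_over_isometry_image[OF iso] symmetry_surface_centroid[OF g(1)] g(2) by simp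
    have "emeasure lborel (cone_over ?s F) = emeasure lborel (cone_over ?s F\<^sub>0)"
      using emeasure_lborel_isometry_image[OF iso polar_formula_cone_borel[OF C(2)]]
        polar_formula_cone_borel[OF D(2)] by (simp add: cone)
    moreover have "emeasure area_measure F = emeasure area_measure F\<^sub>0"
      using area_outer_isometry_image[OF iso, of F\<^sub>0] facetD(7)[OF F] facetD(7)[OF F\<^sub>0] g(2)
      by (simp add: emeasure_area_measure)
    ultimately have "D * (ennreal (1 / 3) * emeasure area_measure F\<^sub>0) = C * (ennreal (1 / 3) * emeasure area_measure F\<^sub>0)"
      using polar_formula_volume[OF C(2) facetD(7)[OF F\<^sub>0]] polar_formula_volume[OF D(2) facetD(7)[OF F]]
      by (simp add: mult.assoc)
    moreover have "ennreal (1 / 3) * emeasure area_measure F\<^sub>0 \<noteq> 0"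
      "ennreal (1 / 3) * emeasure area_measure F\<^sub>0 \<noteq> top"
      using facet_area[OF F\<^sub>0] by (auto simp: ennreal_mult_eq_top_iff)
    ultimately have "D = C" by (metis ennreal_mult_cancel_left mult.commute)
    with D(2) show ?thesis by simp
  qed
  with C(1) show ?thesis by blast
qed

text \<open>Nonnegativity lets the estimates run in \<open>ennreal\<close>, the home of the polar
  formula. Both means are multiplied by volume and surface area.\<close>

lemma jensen_nonneg:
  assumes conv: "convex_on X f" and f [measurable]: "f \<in> borel_measurable borel"
    and nonneg: "\<And>x. 0 \<le> f x" and bdd: "\<And>x. x \<in> X \<Longrightarrow> f x \<le> B"
  shows "(\<integral>x. indicator X x * f x \<partial>lborel) * measure surface UNIV
      \<le> measure lborel X * (\<integral>y. f y \<partial>surface)"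
proof -
  let ?s = surface_centroid
  interpret finite_measure surface by (rule finite_measure_surface)
  note s = surface_centroid_interior
  have sX: "?s \<in> X" by (rule surface_centroid_in_body)
  have XB [measurable]: "X \<in> sets borel" using closed by simp
  obtain C where C: "C < \<infinity>" "\<And>F. F \<in> facets \<Longrightarrow> polar_formula C ?s F"
    using common_polar_formula by blast
  define h where "h x = ennreal (indicator X x * f x)" for x
  have [measurable]: "h \<in> borel_measurable borel" unfolding h_def[abs_def] by measurable
  have cone: "(\<integral>\<^sup>+x. h x * indicator (cone_over ?s F) x \<partial>lborel)
      \<le> C * (ennreal (f ?s / 12) * emeasure area_measure F
          + ennreal (1 / 4) * (\<integral>\<^sup>+y. h y * indicator F y \<partial>area_measure))"
    if F: "F \<in> facets" for F
  proof -
    define m where "m = emeasure area_measure F"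
    define J where "J = (\<integral>\<^sup>+y. h y * indicator F y \<partial>area_measure)"
    have FB [measurable]: "F \<in> sets borel" by (rule facetD(7)[OF F])
    \<comment> \<open>Convexity on the segment from the centroid to \<open>y\<close>, integrated
      over \<open>y\<close> for a fixed \<open>t\<close>.\<close>
    have slice: "(\<integral>\<^sup>+y. h (?s + t *\<^sub>R (y - ?s)) * indicator F y \<partial>area_measure)
        \<le> ennreal ((1 - t) * f ?s) * m + ennreal t * J" if t: "0 < t" "t \<le> 1" for t
    proof -
      have "(\<integral>\<^sup>+y. h (?s + t *\<^sub>R (y - ?s)) * indicator F y \<partial>area_measure)
          \<le> (\<integral>\<^sup>+y. ennreal ((1 - t) * f ?s) * indicator F y + ennreal t * (h y * indicator F y) \<partial>area_measure)"
      proof (rule nn_integral_mono)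
        fix y
        show "h (?s + t *\<^sub>R (y - ?s)) * indicator F y
            \<le> ennreal ((1 - t) * f ?s) * indicator F y + ennreal t * (h y * indicator F y)"
        proof (cases "y \<in> F")
          case True
          then have y: "y \<in> X" using facetD(6)[OF F] frontier_eq by auto
          have eq: "?s + t *\<^sub>R (y - ?s) = (1 - t) *\<^sub>R ?s + t *\<^sub>R y" by (simp add: algebra_simps)
          have "?s + t *\<^sub>R (y - ?s) \<in> X"
            unfolding eq using convexD[OF convex sX y, of "1 - t" t] t by simp
          moreover have "f (?s + t *\<^sub>R (y - ?s)) \<le> (1 - t) * f ?s + t * f y"
            unfolding eq using conv sX y t by (simp add: convex_on_def)
          ultimately have "h (?s + t *\<^sub>R (y - ?s)) \<le> ennreal ((1 - t) * f ?s + t * f y)"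
            by (simp add: h_def ennreal_leI)
          also have "\<dots> = ennreal ((1 - t) * f ?s) + ennreal t * h y"
            using t nonneg y by (simp add: h_def ennreal_plus ennreal_mult)
          finally show ?thesis using True by simp
        qed simp
      qed
      also have "\<dots> = ennreal ((1 - t) * f ?s) * m + ennreal t * J"
        by (subst nn_integral_add) (simp_all add: nn_integral_cmult m_def J_def)
      finally show ?thesis .
    qed
    have "(\<integral>\<^sup>+x. h x * indicator (cone_over ?s F) x \<partial>lborel)
        = C * (\<integral>\<^sup>+t. ennreal (t\<^sup>2) * indicator {0<..1} t *
          (\<integral>\<^sup>+y. h (?s + t *\<^sub>R (y - ?s)) * indicator F y \<partial>area_measure) \<partial>lborel)"
      by (rule polar_formula_nn_integral[OF C(2)[OF F]]) simp
    \<comment> \<open>Multiplied by \<open>t^2\<close>, the two terms of the convexity bound carry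
      \<open>t^2 (1 - t)\<close> and \<open>t^3\<close>, whose integrals are 1/12 and 1/4.\<close>
    also have "\<dots> \<le> C * (\<integral>\<^sup>+t. (ennreal (t\<^sup>2 * (1 - t)) * indicator {0<..1} t) * (ennreal (f ?s) * m)
        + (ennreal (t ^ 3) * indicator {0<..1} t) * J \<partial>lborel)"
    proof (intro mult_left_mono nn_integral_mono)
      fix t :: real
      show "ennreal (t\<^sup>2) * indicator {0<..1} t *
          (\<integral>\<^sup>+y. h (?s + t *\<^sub>R (y - ?s)) * indicator F y \<partial>area_measure)
        \<le> (ennreal (t\<^sup>2 * (1 - t)) * indicator {0<..1} t) * (ennreal (f ?s) * m)
          + (ennreal (t ^ 3) * indicator {0<..1} t) * J"
      proof (cases "0 < t \<and> t \<le> 1")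
        case True
        then have "ennreal (t\<^sup>2) * (\<integral>\<^sup>+y. h (?s + t *\<^sub>R (y - ?s)) * indicator F y \<partial>area_measure)
            \<le> ennreal (t\<^sup>2) * (ennreal ((1 - t) * f ?s) * m + ennreal t * J)"
          by (intro mult_left_mono slice) auto
        also have "\<dots> = ennreal (t\<^sup>2 * (1 - t)) * (ennreal (f ?s) * m) + ennreal (t ^ 3) * J"
          using True nonneg by (simp add: ennreal_mult distrib_left mult.assoc power3_eq_cube power2_eq_square)
        finally show ?thesis using True by simp
      qed auto
    qed auto
    also have "(\<integral>\<^sup>+t. (ennreal (t\<^sup>2 * (1 - t)) * indicator {0<..1} t) * (ennreal (f ?s) * m)
        + (ennreal (t ^ 3) * indicator {0<..1} t) * J \<partial>lborel)
        = ennreal (1 / 12) * (ennreal (f ?s) * m) + ennreal (1 / 4) * J"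
      using nn_integral_power_Ioc[of 3]
      by (subst nn_integral_add) (simp_all add: nn_integral_multc nn_integral_square_mult_Ioc)
    also have "ennreal (1 / 12) * (ennreal (f ?s) * m) = ennreal (f ?s / 12) * m"
      using nonneg[of ?s] by (simp add: mult.assoc[symmetric] ennreal_mult[symmetric])
    finally show ?thesis by (simp add: m_def J_def)
  qed
  define S where "S = measure surface UNIV"
  define V where "V = measure lborel X"
  define U where "U = (\<integral>x. indicator X x * f x \<partial>lborel)"
  define I where "I = (\<integral>y. f y \<partial>surface)"
  obtain c where c: "C = ennreal c" "0 \<le> c" using C(1) by (cases C) auto
  have fin: "emeasure lborel X < \<infinity>" using bounded by (rule emeasure_bounded_finite)
  \<comment> \<open>With a common \<open>C\<close> the volume is \<open>C / 3\<close> times the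
    whole surface area, which later allows \<open>C\<close> to be eliminated.\<close>
  have V: "ennreal V = C * ennreal (1 / 3) * ennreal S"
  proof -
    have "ennreal V = (\<integral>\<^sup>+x. 1 * indicator X x \<partial>lborel)"
      using fin by (simp add: V_def emeasure_eq_ennreal_measure less_top)
    also have "\<dots> = (\<Sum>F\<in>facets. \<integral>\<^sup>+x. 1 * indicator (cone_over ?s F) x \<partial>lborel)"
      by (rule nn_integral_body[OF s]) simp
    also have "\<dots> = (\<Sum>F\<in>facets. C * ennreal (1 / 3) * emeasure area_measure F)"
      using polar_formula_volume[OF C(2) facetD(7)] polar_formula_cone_borel[OF C(2)]
      by (intro sum.cong) auto
    also have "\<dots> = C * ennreal (1 / 3) * ennreal S"
      using emeasure_surface_facets
      by (simp add: sum_distrib_left S_def emeasure_eq_measure)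
    finally show ?thesis .
  qed
  have int_surface: "integrable surface f"
    by (rule integrable_surface_bounded[OF f]) (use bdd nonneg in auto)
  have J: "ennreal I = (\<Sum>F\<in>facets. \<integral>\<^sup>+y. h y * indicator F y \<partial>area_measure)"
  proof -
    have "ennreal I = (\<integral>\<^sup>+y. ennreal (f y) \<partial>surface)"
      unfolding I_def using int_surface nonneg by (simp add: nn_integral_eq_integral)
    also have "\<dots> = (\<Sum>F\<in>facets. \<integral>\<^sup>+y. ennreal (f y) * indicator F y \<partial>area_measure)"
      by (rule nn_integral_surface_facets) simp
    also have "\<dots> = (\<Sum>F\<in>facets. \<integral>\<^sup>+y. h y * indicator F y \<partial>area_measure)"
    proof (intro sum.cong nn_integral_cong refl)
      fix F y assume "F \<in> facets"
      then have "F \<subseteq> X" using facetD(6) frontier_eq by blast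
      then show "ennreal (f y) * indicator F y = h y * indicator F y"
        by (auto simp: h_def indicator_def)
    qed
    finally show ?thesis .
  qed
  have "integrable lborel (\<lambda>x. indicator X x *\<^sub>R f x)"
    by (rule integrableI_bounded_set_indicator[where B = B]) (use fin bdd nonneg in auto)
  then have "ennreal U = (\<integral>\<^sup>+x. h x \<partial>lborel)"
    unfolding U_def h_def using nonneg by (subst nn_integral_eq_integral) auto
  also have "\<dots> = (\<integral>\<^sup>+x. h x * indicator X x \<partial>lborel)"
    by (intro nn_integral_cong) (auto simp: h_def indicator_def)
  also have "\<dots> = (\<Sum>F\<in>facets. \<integral>\<^sup>+x. h x * indicator (cone_over ?s F) x \<partial>lborel)"
    by (rule nn_integral_body[OF s]) simp
  also have "\<dots> \<le> (\<Sum>F\<in>facets. C * (ennreal (f ?s / 12) * emeasure area_measure F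
          + ennreal (1 / 4) * (\<integral>\<^sup>+y. h y * indicator F y \<partial>area_measure)))"
    by (intro sum_mono cone)
  also have "\<dots> = C * (ennreal (f ?s / 12) * ennreal S + ennreal (1 / 4) * ennreal I)"
    using emeasure_surface_facets
    by (simp add: J sum_distrib_left[symmetric] sum.distrib S_def emeasure_eq_measure)
  finally have U: "ennreal U \<le> C * (ennreal (f ?s / 12) * ennreal S + ennreal (1 / 4) * ennreal I)" .
  have S0: "0 < S" by (simp add: S_def measure_surface_pos)
  have I0: "0 \<le> I" unfolding I_def using nonneg by simp
  have V_eq: "V = c * S / 3"
    using V c S0 by (simp add: V_def ennreal_mult[symmetric])
  have "U \<le> c * (f ?s / 12 * S + I / 4)"
    using U c S0 I0 nonneg[of ?s]
    by (simp add: ennreal_mult[symmetric] ennreal_plus[symmetric] ennreal_le_iff del: ennreal_plus)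
  moreover have "f ?s * S \<le> I"
    unfolding S_def I_def by (rule surface_jensen[OF conv f int_surface s])
  \<comment> \<open>Since 1/12 + 1/4 = 1/3, bounding \<open>f ?s * S\<close> by \<open>I\<close>
    produces exactly the factor that occurs in \<open>V = c * S / 3\<close>.\<close>
  then have "(f ?s * S) / 12 + I / 4 \<le> I / 3" by linarith
  then have "f ?s / 12 * S + I / 4 \<le> I / 3" by simp
  then have "c * (f ?s / 12 * S + I / 4) \<le> c * (I / 3)"
    using c(2) by (rule mult_left_mono)
  ultimately have "U * S \<le> (c * (I / 3)) * S" using S0 by (intro mult_right_mono) auto
  also have "\<dots> = V * I" using V_eq by simp
  finally show ?thesis by (simp add: U_def V_def I_def S_def)
qed

text \<open>A general \<open>f\<close> is arbitrary outside \<open>X\<close> and may be negative on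
  it. Extension by zero makes it Borel measurable; subtracting a lower bound makes it nonnegative
  and shifts both means by the same constant.\<close>

lemma jensen_type_body: "jensen_type X"
  unfolding jensen_type_def
proof (intro conjI allI impI)
  show "convex X" "closed X" by (fact convex closed)+
  fix f assume f: "convex_on X f"
  interpret finite_measure surface by (rule finite_measure_surface)
  define f\<^sub>1 where "f\<^sub>1 x = indicator X x * f x" for x
  have f1 [measurable]: "f\<^sub>1 \<in> borel_measurable borel"
    unfolding f\<^sub>1_def by (rule convex_on_polytope_borel_measurable[OF polytope f])
  have f1_eq: "f\<^sub>1 x = f x" if "x \<in> X" for x using that by (simp add: f\<^sub>1_def)
  have XB [measurable]: "X \<in> sets borel" using closed by simp
  obtain b where b: "\<And>x. x \<in> X \<Longrightarrow> b \<le> f x"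
    using convex_on_bounded_below[OF f interior_nonempty bounded] by metis
  obtain B where B: "\<And>x. x \<in> X \<Longrightarrow> f x \<le> B"
    using convex_on_polytope_bounded_above[OF polytope f] by metis
  have norm: "norm (f\<^sub>1 x) \<le> max \<bar>b\<bar> \<bar>B\<bar>" if "x \<in> X" for x
    using b[OF that] B[OF that] f1_eq[OF that] by (auto simp: abs_le_iff)
  have fin: "emeasure lborel X < \<infinity>" using bounded by (rule emeasure_bounded_finite)
  have int_X: "integrable lborel (\<lambda>x. indicator X x *\<^sub>R f\<^sub>1 x)"
    by (rule integrableI_bounded_set_indicator[where B = "max \<bar>b\<bar> \<bar>B\<bar>"]) (use fin norm in auto)
  have X_eq: "(\<lambda>x. indicator X x *\<^sub>R f x) = (\<lambda>x. indicator X x *\<^sub>R f\<^sub>1 x)"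
    by (auto simp: f\<^sub>1_def indicator_def)
  show "set_integrable lebesgue X f"
    unfolding set_integrable_def X_eq using int_X by (rule integrable_completion[THEN iffD2, rotated]) simp
  have X_int: "(LINT x:X|lebesgue. f x) = (\<integral>x. indicator X x *\<^sub>R f\<^sub>1 x \<partial>lborel)"
    unfolding set_lebesgue_integral_def X_eq by (rule integral_completion) simp
  have int_surface: "integrable surface f\<^sub>1"
    by (rule integrable_surface_bounded[OF f1 norm])
  have F_eq: "(\<lambda>x. indicator (frontier X) x *\<^sub>R f x) = (\<lambda>x. indicator (frontier X) x *\<^sub>R f\<^sub>1 x)"
    using frontier_eq by (auto simp: f\<^sub>1_def indicator_def)
  show "set_integrable area_measure (frontier X) f"
    using int_surface unfolding integral_surface(2)[OF f1] set_integrable_def F_eq .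
  have F_int: "(LINT y:frontier X|area_measure. f y) = (\<integral>y. f\<^sub>1 y \<partial>surface)"
    unfolding integral_surface(1)[OF f1] set_lebesgue_integral_def F_eq ..
  \<comment> \<open>The second cut-off is there because \<open>f\<^sub>1 - b\<close> equals
    \<open>-b\<close> outside \<open>X\<close>, which may be negative.\<close>
  define f\<^sub>2 where "f\<^sub>2 x = indicator X x * (f\<^sub>1 x - b)" for x
  have f2 [measurable]: "f\<^sub>2 \<in> borel_measurable borel" unfolding f\<^sub>2_def by measurable
  have f2_eq: "f\<^sub>2 x = f x - b" if "x \<in> X" for x using that by (simp add: f\<^sub>2_def f1_eq)
  have conv2: "convex_on X f\<^sub>2"
    unfolding convex_on_def
  proof (intro conjI ballI allI impI)
    fix x y and u v :: real
    assume xy: "x \<in> X" "y \<in> X" and uv: "0 \<le> u" "0 \<le> v" "u + v = 1"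
    have "u *\<^sub>R x + v *\<^sub>R y \<in> X" using convexD[OF convex xy uv] .
    moreover have "f (u *\<^sub>R x + v *\<^sub>R y) \<le> u * f x + v * f y"
      using f xy uv by (simp add: convex_on_def)
    moreover have "u * f x + v * f y - b = u * (f x - b) + v * (f y - b)"
    proof -
      have "b = u * b + v * b" using uv(3) by (metis distrib_right mult_1)
      then show ?thesis by (simp add: right_diff_distrib)
    qed
    ultimately show "f\<^sub>2 (u *\<^sub>R x + v *\<^sub>R y) \<le> u * f\<^sub>2 x + v * f\<^sub>2 y"
      using xy by (simp add: f2_eq)
  qed (rule convex)
  have ineq: "(\<integral>x. indicator X x * f\<^sub>2 x \<partial>lborel) * measure surface UNIV
      \<le> measure lborel X * (\<integral>y. f\<^sub>2 y \<partial>surface)"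
  proof (rule jensen_nonneg[OF conv2 f2, of "B - b"])
    show "0 \<le> f\<^sub>2 x" for x using b[of x] by (simp add: f\<^sub>2_def indicator_def f1_eq)
    show "f\<^sub>2 x \<le> B - b" if "x \<in> X" for x using B[OF that] by (simp add: f2_eq that)
  qed
  have X2: "(\<integral>x. indicator X x * f\<^sub>2 x \<partial>lborel)
      = (\<integral>x. indicator X x *\<^sub>R f\<^sub>1 x \<partial>lborel) - measure lborel X * b"
  proof -
    have "(\<integral>x. indicator X x * f\<^sub>2 x \<partial>lborel)
        = (\<integral>x. indicator X x *\<^sub>R f\<^sub>1 x - indicator X x * b \<partial>lborel)"
      by (intro Bochner_Integration.integral_cong) (auto simp: f\<^sub>2_def indicator_def)
    also have "\<dots> = (\<integral>x. indicator X x *\<^sub>R f\<^sub>1 x \<partial>lborel) - (\<integral>x. indicator X x * b \<partial>lborel)"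
      using int_X fin by (intro Bochner_Integration.integral_diff) auto
    finally show ?thesis by simp
  qed
  have F2: "(\<integral>y. f\<^sub>2 y \<partial>surface) = (\<integral>y. f\<^sub>1 y \<partial>surface) - measure surface UNIV * b"
  proof -
    have "(\<integral>y. f\<^sub>2 y \<partial>surface) = (\<integral>y. f\<^sub>1 y - b \<partial>surface)"
    proof (rule integral_cong_AE)
      show "AE y in surface. f\<^sub>2 y = f\<^sub>1 y - b"
        using AE_surface by eventually_elim (use frontier_eq in \<open>auto simp: f\<^sub>2_def\<close>)
    qed simp_all
    also have "\<dots> = (\<integral>y. f\<^sub>1 y \<partial>surface) - (\<integral>y. b \<partial>surface)"
      using int_surface by (intro Bochner_Integration.integral_diff) auto
    finally show ?thesis by simp
  qed
  \<comment> \<open>The terms with \<open>b\<close> are volume times surface area times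
    \<open>b\<close> on both sides and cancel.\<close>
  from ineq have main: "(\<integral>x. indicator X x *\<^sub>R f\<^sub>1 x \<partial>lborel) * measure surface UNIV
      \<le> measure lborel X * (\<integral>y. f\<^sub>1 y \<partial>surface)"
    unfolding X2 F2 by (simp add: left_diff_distrib right_diff_distrib mult_ac del: real_scaleR_def)
  have "\<not> negligible X"
    using convex interior_nonempty by (simp add: negligible_convex_interior)
  then have "emeasure lborel X \<noteq> 0"
    using XB by (simp add: negligible_iff_null_sets null_sets_completion_iff null_sets_def)
  then have V: "0 < measure lborel X"
    using fin by (simp add: measure_def enn2real_positive_iff zero_less_iff_neq_zero)
  have "measure lebesgue X = measure lborel X" using XB by (simp add: measure_completion)
  then show "1 / measure lebesgue X * (LINT x:X|lebesgue. f x)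
      \<le> 1 / measure area_measure (frontier X) * (LINT y:frontier X|area_measure. f y)"
    using main V measure_surface_pos
    unfolding X_int F_int measure_surface by (simp add: field_simps)
qed

end

theorem mainTheorem5:
  fixes X :: "(real^3) set"
  assumes "platonic_solid X"
  shows "jensen_type X"
proof -
  interpret polytope_body X
    by standard (use assms in \<open>simp_all add: platonic_solid_def\<close>)
  interpret facet_transitive_body X
  proof
    fix F G assume "F \<in> facets" "G \<in> facets"
    then obtain V E V' E' where "is_flag X V E F" "is_flag X V' E' G"
      using facet_in_flag by blast
    then show "\<exists>g. is_symmetry X g \<and> g ` F = G"
      using assms unfolding platonic_solid_def by blast
  qed
  show ?thesis by (rule jensen_type_body)
qed

end
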